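(* Let $X\subseteq\mathbb{R}^2$ be a finite union of sets of the form $$\{\Phi_{g_1,\theta_1}=0\}\cap\cdots\cap\{\Phi_{g_m,\theta_m}=0\}\cap\{\Phi_{f_1,\beta_1}>0\}\cap\cdots\cap\{\Phi_{f_k,\beta_k}>0\},$$ where $g_i,f_j$ are real polynomials in one variable and $\theta_i,\beta_j$ are angles. Then there exists a cell decomposition of $X$ such that every shortest-length curve between two points of $X$ interacts with each cell at most finitely many times.
   Context: For a real polynomial $p$ and angle $\theta$, $\Phi_{p,\theta}(x,y)=p(x\cos\theta+y\sin\theta)-(-x\sin\theta+y\cos\theta)$; $\{\Phi_{p,\theta}=0\}$ is the graph of $p$ in the coordinate frame rotated by $\theta$, and $\{\Phi_{p,\theta}>0\}$ is the open region below that graph (an open polynomial half plane). A shortest-length curve between $A$ and $B$ in $X$ is a continuous piecewise $C^2$ curve in $X$ from $A$ to $B$ of minimal length $\int|\gamma'|$ among all piecewise $C^2$ curves in $X$ from $A$ to $B$. A cell decomposition of $X$ is a partition of $X$ into at most countably many pairwise disjoint cells, each homeomorphic to $\mathbb{R}^d$, $d\in\{0,1,2\}$. A curve $\gamma$ interacts with a set $e$ at most $N$ times if $\gamma^{-1}(e)$ has at most $N$ connected components. *)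

theory Defs
  imports "HOL-Analysis.Analysis" "HOL-Computational_Algebra.Polynomial"
begin

definition Phi :: "real poly \<Rightarrow> real \<Rightarrow> real \<times> real \<Rightarrow> real" where
  "Phi p \<theta> z = poly p (fst z * cos \<theta> + snd z * sin \<theta>) - (- fst z * sin \<theta> + snd z * cos \<theta>)"

definition basic_set :: "(real poly \<times> real) list \<Rightarrow> (real poly \<times> real) list \<Rightarrow> (real \<times> real) set" where
  "basic_set eqs ineqs =
     {z. (\<forall>(g,\<theta>)\<in>set eqs. Phi g \<theta> z = 0) \<and> (\<forall>(f,\<beta>)\<in>set ineqs. Phi f \<beta> z > 0)}"

definition is_cell :: "(real \<times> real) set \<Rightarrow> bool" where
  "is_cell e \<longleftrightarrow> (\<exists>p. e = {p}) \<or> e homeomorphic (UNIV :: real set)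
                 \<or> e homeomorphic (UNIV :: (real \<times> real) set)"

definition cell_decomposition :: "(real \<times> real) set set \<Rightarrow> (real \<times> real) set \<Rightarrow> bool" where
  "cell_decomposition C X \<longleftrightarrow> countable C \<and> disjoint C \<and> \<Union>C = X \<and> (\<forall>e\<in>C. is_cell e)"

definition C2_on_interval :: "real \<Rightarrow> real \<Rightarrow> (real \<Rightarrow> real \<times> real) \<Rightarrow> bool" where
  "C2_on_interval u v \<gamma> \<longleftrightarrow> (\<exists>g g' g''. (\<forall>t\<in>{u..v}. g t = \<gamma> t)
      \<and> (\<forall>t. (g has_vector_derivative g' t) (at t))
      \<and> (\<forall>t. (g' has_vector_derivative g'' t) (at t))
      \<and> continuous_on UNIV g'')"

definition piecewise_C2 :: "(real \<Rightarrow> real \<times> real) \<Rightarrow> bool" where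
  "piecewise_C2 \<gamma> \<longleftrightarrow> continuous_on {0..1} \<gamma> \<and>
     (\<exists>n::nat. \<exists>t::nat \<Rightarrow> real. t 0 = 0 \<and> t n = 1 \<and> (\<forall>i<n. t i < t (Suc i))
        \<and> (\<forall>i<n. C2_on_interval (t i) (t (Suc i)) \<gamma>))"

definition curve_length :: "(real \<Rightarrow> real \<times> real) \<Rightarrow> real" where
  "curve_length \<gamma> = integral {0..1} (\<lambda>t. norm (vector_derivative \<gamma> (at t)))"

definition curve_in :: "(real \<times> real) set \<Rightarrow> real \<times> real \<Rightarrow> real \<times> real \<Rightarrow> (real \<Rightarrow> real \<times> real) \<Rightarrow> bool" where
  "curve_in X A B \<gamma> \<longleftrightarrow> piecewise_C2 \<gamma> \<and> \<gamma> ` {0..1} \<subseteq> X \<and> \<gamma> 0 = A \<and> \<gamma> 1 = B"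

definition shortest_curve :: "(real \<times> real) set \<Rightarrow> real \<times> real \<Rightarrow> real \<times> real \<Rightarrow> (real \<Rightarrow> real \<times> real) \<Rightarrow> bool" where
  "shortest_curve X A B \<gamma> \<longleftrightarrow> curve_in X A B \<gamma> \<and>
     (\<forall>\<eta>. curve_in X A B \<eta> \<longrightarrow> curve_length \<gamma> \<le> curve_length \<eta>)"

definition interacts_finitely :: "(real \<Rightarrow> real \<times> real) \<Rightarrow> (real \<times> real) set \<Rightarrow> bool" where
  "interacts_finitely \<gamma> e \<longleftrightarrow> finite (components {t\<in>{0..1}. \<gamma> t \<in> e})"

end

theory Submission
  imports Defs
begin

text \<open>A convex cell inside \<open>X\<close> is met in at most one interval of time, because the chord between
  two of its points is the unique shortest curve between them. As countably many cells are allowed,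
  the open part of \<open>X\<close> off all the zero curves is cut into dyadic squares, edges and vertices. What
  is left lies on finitely many polynomial graphs, and apart from finitely many points it is cut into
  short arcs on which the graph is linear or has curvature of constant sign, with each side locally
  inside or locally outside \<open>X\<close>. If the convex side of such an arc lies in \<open>X\<close>, chords of the arc lie in
  \<open>X\<close> and a shortest curve meets the arc in at most two points. Otherwise a shortest curve between two
  points of the arc cannot leave it: where it is strictly on the other side it would be straight, but
  chords of the graph lie on the convex side.\<close>

section \<open>Shortest curves\<close>

text \<open>All comparisons replace the curve on one time interval by a competitor: a chord, where
  equality in the triangle inequality puts every intermediate point on the segment, or a piece of
  the graph itself. The second competitor answers the main obstacle: \<open>X\<close> is understood
  only locally near an arc, while a shortest curve between two points of the arc might wander off.
  Hence arcs are taken inside a ball of radius \<open>\<rho> / 2\<close> and of length at most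
  \<open>\<rho> / 2\<close>; comparison with the arc then confines the curve to the ball of radius
  \<open>\<rho>\<close>. That each side of a short arc is uniformly inside or outside
  \<open>X\<close> rests on rigidity: another defining function, restricted to the graph, is a
  polynomial in the parameter, so it vanishes finitely often or identically. In the latter case the
  two zero curves coincide, and the sign of the other function is constant on each side of the
  graph. Squares may shrink and accumulate at the zero curves, because finiteness is asked of each
  cell separately.\<close>

text \<open>A finite set of possible corners replaces the ordered list of breakpoints: restriction
  to a subinterval keeps the same \<open>S\<close>, and new corners are simply added to it.\<close>

definition C2_off :: "real set \<Rightarrow> real \<Rightarrow> real \<Rightarrow> (real \<Rightarrow> real \<times> real) \<Rightarrow> bool" where
  "C2_off S a b \<gamma> \<longleftrightarrow>
     (\<forall>u v. a \<le> u \<longrightarrow> u < v \<longrightarrow> v \<le> b \<longrightarrow> {u<..<v} \<inter> S = {} \<longrightarrow> C2_on_interval u v \<gamma>)"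

text \<open>On \<open>{0..1}\<close> this is \<open>curve_length\<close>. At a corner the two-sided
  derivative may fail to exist, and \<open>vector_derivative\<close> is then an unspecified value;
  finitely many such values do not affect the integral.\<close>

definition arc_length :: "(real \<Rightarrow> real \<times> real) \<Rightarrow> real \<Rightarrow> real \<Rightarrow> real" where
  "arc_length \<gamma> s t = integral {s..t} (\<lambda>r. norm (vector_derivative \<gamma> (at r)))"

lemma C2_on_interval_cong:
  assumes "C2_on_interval u v \<gamma>" "\<And>r. r \<in> {u..v} \<Longrightarrow> \<gamma> r = \<eta> r"
  shows "C2_on_interval u v \<eta>"
proof -
  obtain g g' g'' where g: "\<forall>t\<in>{u..v}. g t = \<gamma> t"
      "\<forall>t. (g has_vector_derivative g' t) (at t)" "\<forall>t. (g' has_vector_derivative g'' t) (at t)"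
      "continuous_on UNIV g''"
    using assms(1) unfolding C2_on_interval_def by blast
  moreover have "\<forall>t\<in>{u..v}. g t = \<eta> t" using g(1) assms(2) by simp
  ultimately show ?thesis unfolding C2_on_interval_def by blast
qed

lemma C2_on_interval_subset:
  assumes "C2_on_interval u v \<gamma>" "u \<le> u'" "v' \<le> v"
  shows "C2_on_interval u' v' \<gamma>"
proof -
  have "{u'..v'} \<subseteq> {u..v}" using assms by auto
  then show ?thesis using assms(1) unfolding C2_on_interval_def by (meson subsetD)
qed

lemma C2_off_subinterval:
  "C2_off S a b \<gamma> \<Longrightarrow> a \<le> a' \<Longrightarrow> b' \<le> b \<Longrightarrow> C2_off S a' b' \<gamma>"
  unfolding C2_off_def by auto

lemma C2_off_insert_outside:
  assumes "C2_off (insert x S) a b \<gamma>" "x \<le> a \<or> b \<le> x"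
  shows "C2_off S a b \<gamma>"
  unfolding C2_off_def
proof (intro allI impI)
  fix u v assume uv: "a \<le> u" "u < v" "v \<le> b" "{u<..<v} \<inter> S = {}"
  then have "{u<..<v} \<inter> insert x S = {}" using assms(2) by auto
  then show "C2_on_interval u v \<gamma>" using assms(1) uv unfolding C2_off_def by blast
qed

text \<open>Corners are removed one at a time: a corner strictly inside the interval splits it, any
  other corner is irrelevant to it. Claims about piecewise curves thus reduce to one smooth piece
  and to gluing.\<close>

lemma C2_off_induct:
  assumes "finite S" "C2_off S a b \<gamma>" "a < b"
    and single: "\<And>u v. a \<le> u \<Longrightarrow> u < v \<Longrightarrow> v \<le> b \<Longrightarrow> C2_on_interval u v \<gamma> \<Longrightarrow> P u v"
    and join: "\<And>u v w. a \<le> u \<Longrightarrow> u < v \<Longrightarrow> v < w \<Longrightarrow> w \<le> b \<Longrightarrow> P u v \<Longrightarrow> P v w \<Longrightarrow> P u w"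
  shows "P a b"
proof -
  have "P u v" if "finite S" "C2_off S u v \<gamma>" "a \<le> u" "u < v" "v \<le> b" for u v
    using that
  proof (induction S arbitrary: u v rule: finite_induct)
    case empty
    then show ?case using single unfolding C2_off_def by auto
  next
    case (insert x S)
    show ?case
    proof (cases "u < x \<and> x < v")
      case True
      have "P u x"
        using insert.IH[of u x] C2_off_subinterval[OF insert.prems(1), of u x]
          C2_off_insert_outside[of x S u x] insert.prems True by auto
      moreover have "P x v"
        using insert.IH[of x v] C2_off_subinterval[OF insert.prems(1), of x v]
          C2_off_insert_outside[of x S x v] insert.prems True by auto
      ultimately show ?thesis using join insert.prems True by blast
    next
      case False
      then show ?thesis
        using C2_off_insert_outside[OF insert.prems(1)] insert.IH insert.prems by auto
    qed
  qed
  then show ?thesis using assms by auto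
qed

lemma piecewise_C2_imp_C2_off:
  assumes "piecewise_C2 \<gamma>"
  obtains S where "finite S" "C2_off S 0 1 \<gamma>"
proof -
  obtain n t where t: "t (0::nat) = (0::real)" "t n = 1" "\<forall>i<n. t i < t (Suc i)"
      and c: "\<forall>i<n. C2_on_interval (t i) (t (Suc i)) \<gamma>"
    using assms unfolding piecewise_C2_def by blast
  have "C2_off (t ` {..n}) 0 1 \<gamma>"
    unfolding C2_off_def
  proof (intro allI impI)
    fix u v :: real
    assume uv: "0 \<le> u" "u < v" "v \<le> 1" "{u<..<v} \<inter> t ` {..n} = {}"
    \<comment> \<open>The last breakpoint not beyond \<open>u\<close>. Its successor lies beyond
      \<open>u\<close>, and as no breakpoint lies strictly between \<open>u\<close> and
      \<open>v\<close>, it is at least \<open>v\<close>.\<close>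
    define i where "i = (GREATEST i. i \<le> n \<and> t i \<le> u)"
    have i: "i \<le> n \<and> t i \<le> u"
      unfolding i_def by (rule GreatestI_nat[where k=0 and b=n]) (use t uv in auto)
    have "i \<noteq> n" using i t uv by auto
    then have "i < n" using i by simp
    have "\<not> t (Suc i) \<le> u"
    proof
      assume "t (Suc i) \<le> u"
      then have "Suc i \<le> i"
        unfolding i_def using \<open>i < n\<close>
        by (intro Greatest_le_nat[where b=n]) (auto simp: i_def)
      then show False by simp
    qed
    moreover have "t (Suc i) \<in> t ` {..n}" using \<open>i < n\<close> by auto
    ultimately have "v \<le> t (Suc i)" using uv(4) by (force simp: disjoint_iff)
    then show "C2_on_interval u v \<gamma>"
      using C2_on_interval_subset c \<open>i < n\<close> i by blast
  qed
  then show ?thesis using that by blast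
qed

lemma C2_off_imp_piecewise_C2:
  assumes "finite S" "C2_off S 0 1 \<gamma>" "continuous_on {0..1} \<gamma>"
  shows "piecewise_C2 \<gamma>"
proof -
  let ?P = "\<lambda>a b. \<exists>n::nat. \<exists>t::nat \<Rightarrow> real. t 0 = a \<and> t n = b \<and> (\<forall>i<n. t i < t (Suc i))
        \<and> (\<forall>i<n. C2_on_interval (t i) (t (Suc i)) \<gamma>)"
  have "?P 0 1"
  proof (rule C2_off_induct[OF assms(1,2), of ?P])
    fix u v :: real assume "u < v" "C2_on_interval u v \<gamma>"
    then show "?P u v"
      by (intro exI[of _ 1] exI[of _ "\<lambda>i. if i = 0 then u else v"]) auto
  next
    fix u v w assume "?P u v" "?P v w"
    then obtain n t n' t' where t: "t (0::nat) = u" "t n = v" "\<forall>i<n. t i < t (Suc i)"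
        "\<forall>i<n. C2_on_interval (t i) (t (Suc i)) \<gamma>"
      and t': "t' (0::nat) = v" "t' n' = w" "\<forall>i<n'. t' i < t' (Suc i)"
        "\<forall>i<n'. C2_on_interval (t' i) (t' (Suc i)) \<gamma>" by metis
    define q where "q i = (if i \<le> n then t i else t' (i - n))" for i
    have q: "q i < q (Suc i) \<and> C2_on_interval (q i) (q (Suc i)) \<gamma>" if "i < n + n'" for i
    proof -
      consider "i < n" | "i = n" | "i > n" by linarith
      then show ?thesis
      proof cases
        case 1 then show ?thesis using t unfolding q_def by auto
      next
        case 2
        then show ?thesis using t t' that unfolding q_def by auto
      next
        case 3
        then have "Suc i - n = Suc (i - n)" "i - n < n'" using that by auto
        then show ?thesis using t' 3 unfolding q_def by auto
      qed
    qed
    have "q (n + n') = w" using t t' unfolding q_def by (cases "n' = 0") auto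
    moreover have "q 0 = u" using t unfolding q_def by auto
    ultimately show "?P u w" using q by blast
  qed auto
  then show ?thesis using assms(3) unfolding piecewise_C2_def by blast
qed

section \<open>Length of piecewise C2 curves\<close>

lemma vector_derivative_cong_open:
  assumes "open U" "x \<in> U" "\<And>r. r \<in> U \<Longrightarrow> f r = g r"
  shows "vector_derivative f (at x) = vector_derivative g (at x)"
proof -
  have "(f has_vector_derivative d) (at x) \<longleftrightarrow> (g has_vector_derivative d) (at x)" for d
    using has_vector_derivative_transform_within_open[of f d x U g]
      has_vector_derivative_transform_within_open[of g d x U f] assms by (metis at_within_open)
  then show ?thesis unfolding vector_derivative_def by simp
qed

lemma arc_length_cong:
  assumes "\<And>r. r \<in> {s<..<t} \<Longrightarrow> \<gamma> r = \<eta> r"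
  shows "arc_length \<gamma> s t = arc_length \<eta> s t"
  unfolding arc_length_def
\<comment> \<open>The two-sided derivatives at \<open>s\<close> and \<open>t\<close> also depend on
  values outside the interval, so these two points are discarded as a null set.\<close>
proof (rule integral_spike[of "{s,t}"])
  fix r assume "r \<in> {s..t} - {s,t}"
  then have "r \<in> {s<..<t}" by auto
  from vector_derivative_cong_open[OF open_greaterThanLessThan this assms]
  show "norm (vector_derivative \<eta> (at r)) = norm (vector_derivative \<gamma> (at r))" by simp
qed auto

lemma C2_on_interval_has_vector_derivative:
  assumes "C2_on_interval u v \<gamma>" "r \<in> {u<..<v}"
  shows "(\<gamma> has_vector_derivative vector_derivative \<gamma> (at r)) (at r)"
proof -
  obtain g g' where g: "\<forall>t\<in>{u..v}. g t = \<gamma> t" "\<forall>t. (g has_vector_derivative g' t) (at t)"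
    using assms unfolding C2_on_interval_def by blast
  have "(\<gamma> has_vector_derivative g' r) (at r)"
    by (rule has_vector_derivative_transform_within_open[of g _ _ "{u<..<v}"]) (use g assms in auto)
  then show ?thesis using vector_derivative_at by metis
qed

lemma C2_on_interval_speed_integrable:
  assumes "C2_on_interval u v \<gamma>"
  shows "(\<lambda>r. norm (vector_derivative \<gamma> (at r))) integrable_on {u..v}"
proof -
  obtain g g' g'' where g: "\<forall>t\<in>{u..v}. g t = \<gamma> t" "\<forall>t. (g has_vector_derivative g' t) (at t)"
      "\<forall>t. (g' has_vector_derivative g'' t) (at t)"
    using assms unfolding C2_on_interval_def by blast
  have "continuous_on {u..v} g'"
    by (intro continuous_at_imp_continuous_on ballI)
       (use g(3) has_vector_derivative_continuous in blast)
  then have "(\<lambda>r. norm (g' r)) integrable_on {u..v}"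
    by (intro integrable_continuous_interval continuous_intros)
  then show ?thesis
  proof (rule integrable_spike[where S="{u,v}"])
    fix r assume "r \<in> {u..v} - {u,v}"
    then have r: "r \<in> {u<..<v}" by auto
    have "vector_derivative \<gamma> (at r) = vector_derivative g (at r)"
      by (rule vector_derivative_cong_open[OF open_greaterThanLessThan r]) (use g in auto)
    then show "norm (vector_derivative \<gamma> (at r)) = norm (g' r)"
      using g(2) vector_derivative_at by metis
  qed auto
qed

lemma speed_integrable:
  assumes "finite S" "C2_off S a b \<gamma>"
  shows "(\<lambda>r. norm (vector_derivative \<gamma> (at r))) integrable_on {a..b}"
proof (cases "a < b")
  case True
  show ?thesis
  proof (rule C2_off_induct[OF assms True])
    fix u v w :: real
    assume "u < v" "v < w" "(\<lambda>r. norm (vector_derivative \<gamma> (at r))) integrable_on {u..v}"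
      "(\<lambda>r. norm (vector_derivative \<gamma> (at r))) integrable_on {v..w}"
    then show "(\<lambda>r. norm (vector_derivative \<gamma> (at r))) integrable_on {u..w}"
      using Henstock_Kurzweil_Integration.integrable_combine[of u v w] by simp
  qed (rule C2_on_interval_speed_integrable)
next
  case False
  then have "measure lborel (cbox a b) = 0" by (simp add: content_real_eq_0)
  then show ?thesis unfolding interval_cbox by (rule integrable_on_null)
qed

lemma arc_length_combine:
  assumes "finite S" "C2_off S a c \<gamma>" "a \<le> b" "b \<le> c"
  shows "arc_length \<gamma> a b + arc_length \<gamma> b c = arc_length \<gamma> a c"
  unfolding arc_length_def
  using Henstock_Kurzweil_Integration.integral_combine[OF assms(3,4) speed_integrable[OF assms(1,2)]] .

lemma C2_off_has_vector_derivative: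
  assumes "finite S" "C2_off S a b \<gamma>" "r \<in> {a<..<b} - S"
  shows "(\<gamma> has_vector_derivative vector_derivative \<gamma> (at r)) (at r)"
proof -
  have "open ({a<..<b} - S)" using assms(1) by (simp add: finite_imp_closed open_Diff)
  then obtain e where e: "e > 0" "cball r e \<subseteq> {a<..<b} - S"
    using assms(3) open_contains_cball by blast
  have "C2_on_interval (r - e) (r + e) \<gamma>"
  proof -
    have "r - e \<in> cball r e" "r + e \<in> cball r e" using e by (auto simp: dist_real_def)
    then have "r - e \<in> {a<..<b}" "r + e \<in> {a<..<b}" using e by blast+
    then have "a \<le> r - e" "r + e \<le> b" by auto
    moreover have "{r-e<..<r+e} \<inter> S = {}" using e by (force simp: cball_eq_atLeastAtMost disjoint_iff subset_iff)
    ultimately show ?thesis using assms(2) e unfolding C2_off_def by auto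
  qed
  then show ?thesis using C2_on_interval_has_vector_derivative e by force
qed

text \<open>For a continuous curve the fundamental theorem of calculus tolerates finitely many
  corners; the norm of the integral is then bounded by the integral of the norm.\<close>

lemma dist_le_arc_length:
  assumes "finite S" "C2_off S a b \<gamma>" "a \<le> b" "continuous_on {a..b} \<gamma>"
  shows "dist (\<gamma> a) (\<gamma> b) \<le> arc_length \<gamma> a b"
proof -
  let ?d = "\<lambda>r. vector_derivative \<gamma> (at r)"
  have "(?d has_integral (\<gamma> b - \<gamma> a)) {a..b}"
  proof (rule fundamental_theorem_of_calculus_interior_strong[OF assms(1,3)])
    fix x assume "x \<in> {a<..<b} - S"
    from C2_off_has_vector_derivative[OF assms(1,2) this]
    show "(\<gamma> has_vector_derivative ?d x) (at x)" .
  qed (rule assms)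
  then have "norm (\<gamma> b - \<gamma> a) \<le> integral {a..b} (\<lambda>r. norm (?d r))"
    using integral_norm_bound_integral[of ?d "{a..b}" "\<lambda>r. norm (?d r)"]
      speed_integrable[OF assms(1,2)]
    by (metis has_integral_integrable integral_unique order_refl)
  then show ?thesis unfolding arc_length_def dist_norm by (simp add: norm_minus_commute)
qed

section \<open>Comparison of a shortest curve with competitors\<close>

text \<open>The competitor is spliced into the curve; the lengths outside the interval from
  \<open>s\<close> to \<open>t\<close> are unchanged and cancel.\<close>

lemma shortest_curve_replace:
  assumes "shortest_curve X A B \<gamma>" "0 \<le> s" "s < t" "t \<le> 1"
    and \<eta>: "C2_on_interval s t \<eta>" "continuous_on {s..t} \<eta>" "\<eta> ` {s..t} \<subseteq> X" "\<eta> s = \<gamma> s" "\<eta> t = \<gamma> t"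
  shows "arc_length \<gamma> s t \<le> arc_length \<eta> s t"
proof -
  have g: "piecewise_C2 \<gamma>" "\<gamma> ` {0..1} \<subseteq> X" "\<gamma> 0 = A" "\<gamma> 1 = B"
    using assms(1) unfolding shortest_curve_def curve_in_def by auto
  have cont: "continuous_on {0..1} \<gamma>" using g(1) unfolding piecewise_C2_def by blast
  obtain S where S: "finite S" "C2_off S 0 1 \<gamma>" using piecewise_C2_imp_C2_off g(1) by blast
  define \<zeta> where "\<zeta> r = (if r \<in> {s..t} then \<eta> r else \<gamma> r)" for r
  define T where "T = S \<union> {s,t}"
  have z1: "\<zeta> r = \<gamma> r" if "r \<le> s \<or> t \<le> r" for r
    using that \<eta> assms(3) unfolding \<zeta>_def by (cases "r = s \<or> r = t") auto
  have z2: "\<zeta> r = \<eta> r" if "r \<in> {s..t}" for r using that unfolding \<zeta>_def by auto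
  have T: "finite T" unfolding T_def using S by auto
  have off: "C2_off T 0 1 \<zeta>"
    unfolding C2_off_def
  proof (intro allI impI)
    fix u v :: real assume uv: "0 \<le> u" "u < v" "v \<le> 1" "{u<..<v} \<inter> T = {}"
    then have "{u<..<v} \<inter> S = {}" "s \<notin> {u<..<v}" "t \<notin> {u<..<v}" unfolding T_def by auto
    then consider "v \<le> s" | "t \<le> u" | "s \<le> u" "v \<le> t" using uv assms by force
    then show "C2_on_interval u v \<zeta>"
    proof cases
      case 3
      then show ?thesis
        using C2_on_interval_cong[OF C2_on_interval_subset[OF \<eta>(1)], of u v \<zeta>] z2 by auto
    qed (use S uv z1 \<open>{u<..<v} \<inter> S = {}\<close> in
      \<open>auto simp: C2_off_def intro!: C2_on_interval_cong[of u v \<gamma> \<zeta>]\<close>)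
  qed
  have "continuous_on ({s..t} \<union> ({0..s} \<union> {t..1})) \<zeta>"
    unfolding \<zeta>_def
    by (rule continuous_on_cases)
       (use cont \<eta> assms in \<open>auto intro: continuous_on_subset\<close>)
  moreover have "{s..t} \<union> ({0..s} \<union> {t..1}) = {0..1}" using assms by auto
  ultimately have "continuous_on {0..1} \<zeta>" by simp
  then have "curve_in X A B \<zeta>"
    unfolding curve_in_def using C2_off_imp_piecewise_C2[OF T off] g \<eta> assms z1 unfolding \<zeta>_def
    by force
  then have "curve_length \<gamma> \<le> curve_length \<zeta>" using assms(1) unfolding shortest_curve_def by blast
  moreover have "arc_length f 0 s + arc_length f s t + arc_length f t 1 = curve_length f"
    if "finite U" "C2_off U 0 1 f" for f U
    using arc_length_combine[OF that, of s]
      arc_length_combine[OF that(1) C2_off_subinterval[OF that(2)], of s 1 t] assms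
    unfolding arc_length_def curve_length_def by auto
  ultimately have "arc_length \<gamma> 0 s + arc_length \<gamma> s t + arc_length \<gamma> t 1
     \<le> arc_length \<zeta> 0 s + arc_length \<zeta> s t + arc_length \<zeta> t 1"
    using S T off by metis
  moreover have "arc_length \<zeta> 0 s = arc_length \<gamma> 0 s" "arc_length \<zeta> t 1 = arc_length \<gamma> t 1"
    by (auto intro!: arc_length_cong z1)
  moreover have "arc_length \<zeta> s t = arc_length \<eta> s t" by (auto intro!: arc_length_cong z2)
  ultimately show ?thesis by simp
qed

lemma shortest_curve_continuous: "shortest_curve X A B \<gamma> \<Longrightarrow> continuous_on {0..1} \<gamma>"
  by (simp add: shortest_curve_def curve_in_def piecewise_C2_def)

lemma shortest_curve_dist_le:
  assumes "shortest_curve X A B \<gamma>" "0 \<le> s" "s \<le> r" "r \<le> t" "t \<le> 1"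
  shows "dist (\<gamma> s) (\<gamma> r) + dist (\<gamma> r) (\<gamma> t) \<le> arc_length \<gamma> s t"
proof -
  obtain S where S: "finite S" "C2_off S 0 1 \<gamma>"
    using piecewise_C2_imp_C2_off assms(1) unfolding shortest_curve_def curve_in_def by metis
  have c: "continuous_on {u..v} \<gamma>" if "0 \<le> u" "v \<le> 1" for u v
    using shortest_curve_continuous[OF assms(1)] that by (auto intro: continuous_on_subset)
  have "dist (\<gamma> s) (\<gamma> r) \<le> arc_length \<gamma> s r" "dist (\<gamma> r) (\<gamma> t) \<le> arc_length \<gamma> r t"
    using dist_le_arc_length[OF S(1) C2_off_subinterval[OF S(2)]] c assms by auto
  moreover have "arc_length \<gamma> s r + arc_length \<gamma> r t = arc_length \<gamma> s t"
    using arc_length_combine[OF S(1) C2_off_subinterval[OF S(2)]] assms by auto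
  ultimately show ?thesis by linarith
qed

text \<open>Against the chord, the piece of the curve has length at most the distance of its ends;
  through \<open>\<gamma> r\<close> it has at least the sum of two distances. So equality holds in
  the triangle inequality, whatever the parametrization.\<close>

lemma shortest_curve_chord:
  assumes "shortest_curve X A B \<gamma>" "0 \<le> s" "s \<le> r" "r \<le> t" "t \<le> 1"
    and X: "closed_segment (\<gamma> s) (\<gamma> t) \<subseteq> X"
  shows "\<gamma> r \<in> closed_segment (\<gamma> s) (\<gamma> t)"
proof (cases "s = t")
  case True then show ?thesis using assms by auto
next
  case False
  then have st: "s < t" using assms by auto
  define w where "w = (1 / (t - s)) *\<^sub>R (\<gamma> t - \<gamma> s)"
  define \<eta> where "\<eta> r = \<gamma> s + (r - s) *\<^sub>R w" for r
  have d: "(\<eta> has_vector_derivative w) (at r)" for r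
    unfolding \<eta>_def by (auto intro!: derivative_eq_intros simp: has_vector_derivative_def)
  have c2: "C2_on_interval s t \<eta>"
    unfolding C2_on_interval_def
    by (intro exI[of _ \<eta>] exI[of _ "\<lambda>_. w"] exI[of _ "\<lambda>_. 0"]) (auto simp: d)
  have img: "\<eta> ` {s..t} \<subseteq> closed_segment (\<gamma> s) (\<gamma> t)"
  proof
    fix z assume "z \<in> \<eta> ` {s..t}"
    then obtain q where q: "q \<in> {s..t}" "z = \<eta> q" by auto
    have "z = (1 - (q - s) / (t - s)) *\<^sub>R \<gamma> s + ((q - s) / (t - s)) *\<^sub>R \<gamma> t"
      using q unfolding \<eta>_def w_def by (simp add: algebra_simps)
    moreover have "0 \<le> (q - s) / (t - s)" "(q - s) / (t - s) \<le> 1" using q st by auto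
    ultimately show "z \<in> closed_segment (\<gamma> s) (\<gamma> t)" unfolding in_segment by blast
  qed
  have "arc_length \<gamma> s t \<le> arc_length \<eta> s t"
  proof (rule shortest_curve_replace[OF assms(1,2) st assms(5) c2])
    show "continuous_on {s..t} \<eta>" unfolding \<eta>_def by (intro continuous_intros)
    show "\<eta> ` {s..t} \<subseteq> X" using img X by blast
    show "\<eta> s = \<gamma> s" "\<eta> t = \<gamma> t" using st unfolding \<eta>_def w_def by auto
  qed
  also have "arc_length \<eta> s t = dist (\<gamma> s) (\<gamma> t)"
    using st unfolding arc_length_def vector_derivative_at[OF d] w_def
    by (simp add: dist_norm norm_minus_commute)
  finally have "dist (\<gamma> s) (\<gamma> t) = dist (\<gamma> s) (\<gamma> r) + dist (\<gamma> r) (\<gamma> t)"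
    using shortest_curve_dist_le[OF assms(1-5)] dist_triangle[of "\<gamma> s" "\<gamma> t" "\<gamma> r"] by linarith
  then show ?thesis using between[of "\<gamma> s" "\<gamma> t" "\<gamma> r"] between_mem_segment by blast
qed

section \<open>Connected components of preimages\<close>

lemma interacts_finitely_if_interval:
  assumes "\<And>s r t. 0 \<le> s \<Longrightarrow> s \<le> r \<Longrightarrow> r \<le> t \<Longrightarrow> t \<le> 1 \<Longrightarrow> \<gamma> s \<in> e \<Longrightarrow> \<gamma> t \<in> e \<Longrightarrow> \<gamma> r \<in> e"
  shows "interacts_finitely \<gamma> e" "connected {t\<in>{0..1}. \<gamma> t \<in> e}"
proof -
  let ?T = "{t\<in>{0..1}. \<gamma> t \<in> e}"
  show c: "connected ?T"
    unfolding connected_iff_interval using assms by auto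
  have "components ?T \<subseteq> {?T}"
  proof (cases "?T = {}")
    case False
    then have "components ?T = {?T}" using c by (simp add: components_eq_sing_iff)
    then show ?thesis by simp
  qed (simp only: components_empty empty_subsetI)
  then show "interacts_finitely \<gamma> e"
    unfolding interacts_finitely_def using finite_subset by blast
qed

lemma shortest_curve_convex_cell:
  assumes "shortest_curve X A B \<gamma>" "convex e" "e \<subseteq> X"
  shows "interacts_finitely \<gamma> e" "connected {t\<in>{0..1}. \<gamma> t \<in> e}"
proof -
  have "\<gamma> r \<in> e" if "0 \<le> s" "s \<le> r" "r \<le> t" "t \<le> 1" "\<gamma> s \<in> e" "\<gamma> t \<in> e" for s r t
    using shortest_curve_chord[OF assms(1) that(1-4)] closed_segment_subset[OF that(5,6) assms(2)]
      assms(3) by blast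
  then show "interacts_finitely \<gamma> e" "connected {t\<in>{0..1}. \<gamma> t \<in> e}"
    using interacts_finitely_if_interval by blast+
qed

text \<open>The chord degenerates to a single point of \<open>X\<close>: a shortest curve may rest
  at a point, but it cannot leave and come back.\<close>

lemma shortest_curve_no_return:
  assumes "shortest_curve X A B \<gamma>" "0 \<le> s" "s \<le> r" "r \<le> t" "t \<le> 1" "\<gamma> s = \<gamma> t"
  shows "\<gamma> r = \<gamma> s"
proof -
  have "\<gamma> t \<in> X" using assms unfolding shortest_curve_def curve_in_def by auto
  then show ?thesis using shortest_curve_chord[OF assms(1-5)] assms(6) by auto
qed

text \<open>Every component contains a whole member of the family, hence the point chosen from that
  member, so the members enumerate the components.\<close>

lemma finite_components_Union:
  assumes "finite \<C>" "\<And>C. C \<in> \<C> \<Longrightarrow> connected C"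
  shows "finite (components (\<Union>\<C>))"
proof -
  let ?f = "\<lambda>C. connected_component_set (\<Union>\<C>) (SOME x. x \<in> C)"
  have "K \<in> ?f ` \<C>" if K_in: "K \<in> components (\<Union>\<C>)" for K
  proof -
    obtain x where x: "x \<in> \<Union>\<C>" and K: "K = connected_component_set (\<Union>\<C>) x"
      using K_in by (rule componentsE)
    from x obtain C where C: "x \<in> C" "C \<in> \<C>" by blast
    have "C \<subseteq> connected_component_set (\<Union>\<C>) x"
      by (rule connected_component_maximal) (use C assms in auto)
    moreover have "(SOME x. x \<in> C) \<in> C" using C(1) by (rule someI)
    ultimately have "(SOME x. x \<in> C) \<in> connected_component_set (\<Union>\<C>) x" by (rule subsetD)
    from connected_component_eq[OF this] have "K = ?f C" using K by simp
    then show ?thesis using C(2) by (rule image_eqI)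
  qed
  then have "components (\<Union>\<C>) \<subseteq> ?f ` \<C>" by (rule subsetI)
  then show ?thesis using assms(1) by (rule finite_surj[rotated])
qed

section \<open>Strictly convex polynomial arcs\<close>

text \<open>The mean value theorem on either side of the intermediate point gives two slopes, and a
  third use, for the derivative, shows that they increase. The convexity gap is the slope difference
  times \<open>l * (1 - l) * (x2 - x1)\<close>.\<close>

lemma poly_strict_convex:
  fixes p :: "real poly"
  assumes pos: "\<And>x. x \<in> {x1..x2} \<Longrightarrow> 0 < poly (pderiv (pderiv p)) x"
    and "x1 < x2" "0 < l" "l < 1"
  shows "poly p ((1 - l) * x1 + l * x2) < (1 - l) * poly p x1 + l * poly p x2"
proof -
  define x where "x = (1 - l) * x1 + l * x2"
  have d: "x - x1 = l * (x2 - x1)" "x2 - x = (1 - l) * (x2 - x1)"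
    unfolding x_def by (simp_all add: algebra_simps)
  then have x: "x1 < x" "x < x2" using assms by (smt (verit) mult_pos_pos)+
  obtain y where y: "x1 < y" "y < x" "poly p x - poly p x1 = (x - x1) * poly (pderiv p) y"
    using poly_MVT[OF x(1)] by blast
  obtain z where z: "x < z" "z < x2" "poly p x2 - poly p x = (x2 - x) * poly (pderiv p) z"
    using poly_MVT[OF x(2)] by blast
  have "y < z" using y z by simp
  then obtain w where w: "y < w" "w < z"
      "poly (pderiv p) z - poly (pderiv p) y = (z - y) * poly (pderiv (pderiv p)) w"
    using poly_MVT[of y z "pderiv p"] by blast
  have "0 < (z - y) * poly (pderiv (pderiv p)) w"
    using pos[of w] w y z x by simp
  then have less: "poly (pderiv p) y < poly (pderiv p) z" using w by simp
  have "(1 - l) * poly p x1 + l * poly p x2 - poly p x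
      = l * (poly p x2 - poly p x) - (1 - l) * (poly p x - poly p x1)"
    by (simp add: algebra_simps)
  also have "\<dots> = (l * (1 - l) * (x2 - x1)) * (poly (pderiv p) z - poly (pderiv p) y)"
    unfolding y(3) z(3) d by (simp add: algebra_simps)
  also have "\<dots> > 0" using less assms by simp
  finally show ?thesis unfolding x_def by simp
qed

section \<open>Graphs in an orthonormal frame\<close>

text \<open>Either orientation of the frame is allowed, so that reversing \<open>v\<close> turns a
  concave graph into a convex one within the same locale.\<close>

locale polynomial_graph =
  fixes u v :: "real \<times> real" and p :: "real poly"
  assumes uu: "u \<bullet> u = 1" and vv: "v \<bullet> v = 1" and uv: "u \<bullet> v = 0"
    and frame: "\<And>z. z = (z \<bullet> u) *\<^sub>R u + (z \<bullet> v) *\<^sub>R v"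
begin

definition graph_point :: "real \<Rightarrow> real \<times> real" where
  "graph_point x = x *\<^sub>R u + poly p x *\<^sub>R v"

text \<open>For the rotated frames this is the negative of \<open>Phi\<close>: positive height means
  above the graph, where \<open>Phi\<close> is negative.\<close>

definition height :: "real \<times> real \<Rightarrow> real" where
  "height z = z \<bullet> v - poly p (z \<bullet> u)"

lemma graph_point_u [simp]: "graph_point x \<bullet> u = x"
  and graph_point_v [simp]: "graph_point x \<bullet> v = poly p x"
  unfolding graph_point_def using uu vv uv by (simp_all add: inner_add_left inner_commute[of v u])

lemma height_graph_point [simp]: "height (graph_point x) = 0"
  unfolding height_def by simp

lemma graph_point_eq: "height z = 0 \<Longrightarrow> graph_point (z \<bullet> u) = z"
  unfolding graph_point_def height_def using frame[of z] by simp

lemma inj_graph_point: "inj graph_point"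
  by (rule inj_on_inverseI[where g="\<lambda>z. z \<bullet> u"]) simp

lemma continuous_on_graph_point: "continuous_on S graph_point"
  unfolding graph_point_def by (intro continuous_intros)

lemma continuous_on_height: "continuous_on S height"
  unfolding height_def by (intro continuous_intros)

lemma graph_arc_is_cell:
  assumes "a < b"
  shows "is_cell (graph_point ` {a<..<b})"
proof -
  have "homeomorphism {a<..<b} (graph_point ` {a<..<b}) graph_point (\<lambda>z. z \<bullet> u)"
    by (rule homeomorphismI) (auto intro!: continuous_on_graph_point continuous_intros)
  then have "{a<..<b} homeomorphic graph_point ` {a<..<b}"
    unfolding homeomorphic_def by (intro exI)
  from homeomorphic_trans[OF homeomorphic_sym[THEN iffD1, OF this]
      homeomorphic_open_interval_UNIV[OF assms]]
  show ?thesis unfolding is_cell_def by simp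
qed

text \<open>Along a segment the first term of \<open>height\<close> is affine and the subtracted one
  strictly convex. On a segment parallel to \<open>v\<close> the height is only affine, which the
  condition \<open>P \<bullet> u \<noteq> Q \<bullet> u\<close> excludes.\<close>

lemma height_segment_strict:
  assumes pos: "\<And>x. x \<in> closed_segment (P \<bullet> u) (Q \<bullet> u) \<Longrightarrow> 0 < poly (pderiv (pderiv p)) x"
    and "0 < l" "l < 1" "P \<bullet> u \<noteq> Q \<bullet> u"
  shows "(1 - l) * height P + l * height Q < height ((1 - l) *\<^sub>R P + l *\<^sub>R Q)"
proof -
  have "poly p ((1 - l) * (P \<bullet> u) + l * (Q \<bullet> u)) < (1 - l) * poly p (P \<bullet> u) + l * poly p (Q \<bullet> u)"
  proof (cases "P \<bullet> u < Q \<bullet> u")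
    case True
    then show ?thesis
      using poly_strict_convex[of "P \<bullet> u" "Q \<bullet> u" p l] assms
      by (auto simp: closed_segment_eq_real_ivl)
  next
    case False
    then show ?thesis
      using poly_strict_convex[of "Q \<bullet> u" "P \<bullet> u" p "1 - l"] assms
      by (auto simp: closed_segment_eq_real_ivl algebra_simps)
  qed
  then show ?thesis unfolding height_def by (simp add: inner_add_left algebra_simps)
qed

lemma height_segment:
  assumes pos: "\<And>x. x \<in> closed_segment (P \<bullet> u) (Q \<bullet> u) \<Longrightarrow> 0 < poly (pderiv (pderiv p)) x"
    and "0 \<le> l" "l \<le> 1"
  shows "(1 - l) * height P + l * height Q \<le> height ((1 - l) *\<^sub>R P + l *\<^sub>R Q)"
proof (cases "0 < l \<and> l < 1 \<and> P \<bullet> u \<noteq> Q \<bullet> u")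
  case True
  then show ?thesis using height_segment_strict[of P Q l] pos by force
next
  case False
  then consider "l = 0" | "l = 1" | "P \<bullet> u = Q \<bullet> u" using assms by force
  then show ?thesis
    by cases (auto simp: height_def inner_add_left algebra_simps)
qed

text \<open>The competitor that follows the graph: time is mapped affinely to the abscissa, so the
  speed is the constant rate times a norm bounded by \<open>M\<close>. The use of
  \<open>closed_segment\<close> covers both orders of \<open>x1\<close> and
  \<open>x2\<close>.\<close>

lemma graph_arc_length_le:
  assumes st: "s < t" and M: "\<And>x. x \<in> closed_segment x1 x2 \<Longrightarrow> norm (u + poly (pderiv p) x *\<^sub>R v) \<le> M"
  obtains \<eta> where "C2_on_interval s t \<eta>" "continuous_on {s..t} \<eta>"
    "\<eta> ` {s..t} \<subseteq> graph_point ` closed_segment x1 x2" "\<eta> s = graph_point x1" "\<eta> t = graph_point x2"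
    "arc_length \<eta> s t \<le> M * \<bar>x2 - x1\<bar>"
proof
  define k where "k = (x2 - x1) / (t - s)"
  define q where "q r = x1 + (r - s) * k" for r
  define \<eta> where "\<eta> r = graph_point (q r)" for r
  define \<eta>' where "\<eta>' r = k *\<^sub>R (u + poly (pderiv p) (q r) *\<^sub>R v)" for r
  define \<eta>'' where "\<eta>'' r = (k * k * poly (pderiv (pderiv p)) (q r)) *\<^sub>R v" for r
  have qd: "(q has_real_derivative k) (at r)" for r
    unfolding q_def by (auto intro!: derivative_eq_intros)
  have pd: "((\<lambda>r. poly f (q r)) has_real_derivative poly (pderiv f) (q r) * k) (at r)" for f r
    using DERIV_chain2[OF poly_DERIV qd] by blast
  have d1: "(\<eta> has_vector_derivative \<eta>' r) (at r)" for r
  proof -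
    have "(\<eta> has_vector_derivative (k *\<^sub>R u + (poly (pderiv p) (q r) * k) *\<^sub>R v)) (at r)"
      unfolding \<eta>_def graph_point_def
      by (intro has_vector_derivative_add has_vector_derivative_scaleR[where g'=0, simplified]
          qd pd has_vector_derivative_const)
    then show ?thesis unfolding \<eta>'_def by (simp add: algebra_simps)
  qed
  have d2: "(\<eta>' has_vector_derivative \<eta>'' r) (at r)" for r
  proof -
    have "((\<lambda>r. u + poly (pderiv p) (q r) *\<^sub>R v) has_vector_derivative
        (0 + (poly (pderiv (pderiv p)) (q r) * k) *\<^sub>R v)) (at r)"
      by (intro has_vector_derivative_add has_vector_derivative_scaleR[where g'=0, simplified]
          pd has_vector_derivative_const)
    from bounded_linear.has_vector_derivative[OF bounded_linear_scaleR_right this, of k]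
    show ?thesis unfolding \<eta>'_def \<eta>''_def by (simp add: algebra_simps)
  qed
  have "continuous_on UNIV \<eta>''" unfolding \<eta>''_def q_def by (intro continuous_intros)
  then show c2: "C2_on_interval s t \<eta>"
    unfolding C2_on_interval_def using d1 d2 by blast
  show "continuous_on {s..t} \<eta>"
    using d1 has_vector_derivative_continuous continuous_at_imp_continuous_on by blast
  have q_in: "q r \<in> closed_segment x1 x2" if "r \<in> {s..t}" for r
  proof -
    define l where "l = (r - s) / (t - s)"
    have "q r = x1 + l * (x2 - x1)" unfolding q_def k_def l_def by simp
    then have "q r = (1 - l) *\<^sub>R x1 + l *\<^sub>R x2" by (simp add: algebra_simps)
    moreover have "0 \<le> l" "l \<le> 1" unfolding l_def using that st by auto
    ultimately show ?thesis unfolding in_segment by blast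
  qed
  then show "\<eta> ` {s..t} \<subseteq> graph_point ` closed_segment x1 x2" unfolding \<eta>_def by auto
  show "\<eta> s = graph_point x1" "\<eta> t = graph_point x2"
    using st unfolding \<eta>_def q_def k_def by auto
  have "arc_length \<eta> s t \<le> integral {s..t} (\<lambda>r. \<bar>k\<bar> * M)"
    unfolding arc_length_def
  proof (rule integral_le)
    show "(\<lambda>r. norm (vector_derivative \<eta> (at r))) integrable_on {s..t}"
      using c2 by (rule C2_on_interval_speed_integrable)
    fix r assume "r \<in> {s..t}"
    then have "norm (\<eta>' r) \<le> \<bar>k\<bar> * M"
      unfolding \<eta>'_def using M[OF q_in] by (simp add: mult_left_mono)
    then show "norm (vector_derivative \<eta> (at r)) \<le> \<bar>k\<bar> * M"
      using vector_derivative_at[OF d1] by simp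
  qed auto
  also have "\<dots> = M * \<bar>x2 - x1\<bar>" using st unfolding k_def by (simp add: abs_divide)
  finally show "arc_length \<eta> s t \<le> M * \<bar>x2 - x1\<bar>" .
qed

text \<open>On a graph, leaving the parameter range between the end points forces a return to a point
  already visited.\<close>

lemma shortest_curve_on_graph_between:
  assumes sc: "shortest_curve X A B \<gamma>" and st: "0 \<le> s" "s \<le> r" "r \<le> t" "t \<le> 1"
    and on: "\<And>q. q \<in> {s..t} \<Longrightarrow> height (\<gamma> q) = 0"
  shows "\<gamma> r \<bullet> u \<in> closed_segment (\<gamma> s \<bullet> u) (\<gamma> t \<bullet> u)"
proof (rule ccontr)
  assume no: "\<gamma> r \<bullet> u \<notin> closed_segment (\<gamma> s \<bullet> u) (\<gamma> t \<bullet> u)"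
  let ?x = "\<lambda>q. \<gamma> q \<bullet> u"
  have cont: "continuous_on {a..b} ?x" if "0 \<le> a" "b \<le> 1" for a b
    using shortest_curve_continuous[OF sc] that
    by (auto intro!: continuous_intros intro: continuous_on_subset)
  \<comment> \<open>The end whose abscissa is nearer to the overshoot is the one whose abscissa is
    attained again, on the other side of time \<open>r\<close>.\<close>
  have "\<exists>q\<in>{s..r}. \<exists>q'\<in>{r..t}. ?x q = ?x q' \<and> ?x q \<noteq> ?x r"
  proof -
    consider "?x r < ?x s" "?x r < ?x t" "?x s \<le> ?x t" | "?x r < ?x s" "?x r < ?x t" "?x t \<le> ?x s"
      | "?x r > ?x s" "?x r > ?x t" "?x s \<le> ?x t" | "?x r > ?x s" "?x r > ?x t" "?x t \<le> ?x s"
      using no unfolding closed_segment_eq_real_ivl by (force split: if_splits)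
    then show ?thesis
    proof cases
      case 1
      then obtain q where "r \<le> q" "q \<le> t" "?x q = ?x s"
        using IVT'[of ?x r "?x s" t] cont[of r t] st by auto
      then show ?thesis using 1 st by (intro bexI[of _ s] bexI[of _ q]) auto
    next
      case 2
      then obtain q where "s \<le> q" "q \<le> r" "?x q = ?x t"
        using IVT2'[of ?x r "?x t" s] cont[of s r] st by auto
      then show ?thesis using 2 st by (intro bexI[of _ q] bexI[of _ t]) auto
    next
      case 3
      then obtain q where "s \<le> q" "q \<le> r" "?x q = ?x t"
        using IVT'[of ?x s "?x t" r] cont[of s r] st by auto
      then show ?thesis using 3 st by (intro bexI[of _ q] bexI[of _ t]) auto
    next
      case 4
      then obtain q where "r \<le> q" "q \<le> t" "?x q = ?x s"
        using IVT2'[of ?x t "?x s" r] cont[of r t] st by auto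
      then show ?thesis using 4 st by (intro bexI[of _ s] bexI[of _ q]) auto
    qed
  qed
  then obtain q q' where q: "q \<in> {s..r}" "q' \<in> {r..t}" "?x q = ?x q'" "?x q \<noteq> ?x r" by blast
  have "\<gamma> q = \<gamma> q'"
  proof -
    have "q \<in> {s..t}" "q' \<in> {s..t}" using q st by auto
    from graph_point_eq[OF on[OF this(1)]] graph_point_eq[OF on[OF this(2)]] q(3)
    show ?thesis by metis
  qed
  then have "\<gamma> r = \<gamma> q"
    using shortest_curve_no_return[OF sc, of q r q'] q st by auto
  then show False using q by simp
qed

text \<open>The height is concave along chords, so a first lowest point strictly below the graph cannot
  lie inside the straight piece that the curve describes around it.\<close>

lemma shortest_curve_height_nonneg:
  assumes sc: "shortest_curve X A B \<gamma>" and st: "0 \<le> s" "s \<le> r" "r \<le> t" "t \<le> 1"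
    and U: "open U" "convex ((\<lambda>z. z \<bullet> u) ` U)"
      "\<And>x. x \<in> (\<lambda>z. z \<bullet> u) ` U \<Longrightarrow> 0 < poly (pderiv (pderiv p)) x"
    and in_U: "\<gamma> ` {s..t} \<subseteq> U"
    and below: "\<And>z. z \<in> U \<Longrightarrow> height z < 0 \<Longrightarrow> z \<in> X"
    and ends: "height (\<gamma> s) = 0" "height (\<gamma> t) = 0"
  shows "0 \<le> height (\<gamma> r)"
proof (rule ccontr)
  assume neg: "\<not> 0 \<le> height (\<gamma> r)"
  have cont: "continuous_on {s..t} \<gamma>"
    using shortest_curve_continuous[OF sc] st by (auto intro: continuous_on_subset)
  have conth: "continuous_on {s..t} (\<lambda>q. height (\<gamma> q))"
    using continuous_on_compose2[OF continuous_on_height cont] by blast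
  obtain q where q: "q \<in> {s..t}" "\<And>q'. q' \<in> {s..t} \<Longrightarrow> height (\<gamma> q) \<le> height (\<gamma> q')"
    using continuous_attains_inf[OF compact_Icc _ conth] st by force
  define m where "m = height (\<gamma> q)"
  have m: "m < 0" using q(2)[of r] neg st unfolding m_def by auto
  have "closed ({s..t} \<inter> (\<lambda>q. height (\<gamma> q)) -` {m})"
    using conth by (intro continuous_closed_preimage) auto
  then have "compact ({s..t} \<inter> (\<lambda>q. height (\<gamma> q)) -` {m})"
    by (auto simp: compact_eq_bounded_closed intro: bounded_subset[of "{s..t}"])
  moreover have "q \<in> {s..t} \<inter> (\<lambda>q. height (\<gamma> q)) -` {m}" using q m_def by auto
  ultimately obtain r0 where r0: "r0 \<in> {s..t}" "height (\<gamma> r0) = m"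
      "\<And>q'. q' \<in> {s..t} \<Longrightarrow> height (\<gamma> q') = m \<Longrightarrow> r0 \<le> q'"
    using compact_attains_inf[of "{s..t} \<inter> (\<lambda>q. height (\<gamma> q)) -` {m}"] by blast
  \<comment> \<open>The curve may rest at its lowest point, so the last visit \<open>r1\<close> to
    \<open>\<gamma> r0\<close> is needed as well: the chord will run from just before
    \<open>r0\<close> to just after \<open>r1\<close>.\<close>
  have "closed ({s..t} \<inter> \<gamma> -` {\<gamma> r0})"
    using cont by (intro continuous_closed_preimage) auto
  then have "compact ({s..t} \<inter> \<gamma> -` {\<gamma> r0})"
    by (auto simp: compact_eq_bounded_closed intro: bounded_subset[of "{s..t}"])
  moreover have "r0 \<in> {s..t} \<inter> \<gamma> -` {\<gamma> r0}" using r0 by auto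
  ultimately obtain r1 where r1: "r1 \<in> {s..t}" "\<gamma> r1 = \<gamma> r0"
      "\<And>q'. q' \<in> {s..t} \<Longrightarrow> \<gamma> q' = \<gamma> r0 \<Longrightarrow> q' \<le> r1"
    using compact_attains_sup[of "{s..t} \<inter> \<gamma> -` {\<gamma> r0}"] by blast
  have ineq: "s < r0" "r0 \<le> r1" "r1 < t"
    using r0 r1 m ends by (force simp: order_less_le)+
  have "open (U \<inter> height -` {..<0})"
    using continuous_open_preimage[OF continuous_on_height U(1), of "{..<0}"] by simp
  moreover have "\<gamma> r0 \<in> U \<inter> height -` {..<0}" using r0 m in_U by auto
  ultimately obtain k where k: "k > 0" "ball (\<gamma> r0) k \<subseteq> U \<inter> height -` {..<0}"
    using open_contains_ball by blast
  have near: "\<exists>d>0. \<forall>q'\<in>{s..t}. dist q' w < d \<longrightarrow> \<gamma> q' \<in> ball (\<gamma> r0) k"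
    if "w \<in> {s..t}" "\<gamma> w = \<gamma> r0" for w
    using cont that k(1) unfolding continuous_on_iff by (metis dist_commute mem_ball)
  obtain d0 where d0: "d0 > 0" "\<forall>q'\<in>{s..t}. dist q' r0 < d0 \<longrightarrow> \<gamma> q' \<in> ball (\<gamma> r0) k"
    using near[of r0] r0 by auto
  obtain d1 where d1: "d1 > 0" "\<forall>q'\<in>{s..t}. dist q' r1 < d1 \<longrightarrow> \<gamma> q' \<in> ball (\<gamma> r0) k"
    using near[of r1] r1 by auto
  define t0 where "t0 = max s (r0 - d0 / 2)"
  define t1 where "t1 = min t (r1 + d1 / 2)"
  have t01: "t0 \<in> {s..t}" "t1 \<in> {s..t}" "t0 < r0" "r1 < t1" "dist t0 r0 < d0" "dist t1 r1 < d1"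
    using ineq d0(1) d1(1) r0(1) r1(1) unfolding t0_def t1_def by (auto simp: dist_real_def)
  then have balls: "\<gamma> t0 \<in> ball (\<gamma> r0) k" "\<gamma> t1 \<in> ball (\<gamma> r0) k" using d0 d1 by auto
  have seg: "closed_segment (\<gamma> t0) (\<gamma> t1) \<subseteq> ball (\<gamma> r0) k"
    by (rule closed_segment_subset[OF balls convex_ball])
  then have "closed_segment (\<gamma> t0) (\<gamma> t1) \<subseteq> X" using k below by blast
  then have "\<gamma> r0 \<in> closed_segment (\<gamma> t0) (\<gamma> t1)"
    using shortest_curve_chord[OF sc, of t0 r0 t1] t01 ineq st by auto
  then obtain l where l: "0 \<le> l" "l \<le> 1" "\<gamma> r0 = (1 - l) *\<^sub>R \<gamma> t0 + l *\<^sub>R \<gamma> t1"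
    unfolding in_segment by blast
  have "0 < poly (pderiv (pderiv p)) x" if "x \<in> closed_segment (\<gamma> t0 \<bullet> u) (\<gamma> t1 \<bullet> u)" for x
  proof -
    have "\<gamma> t0 \<in> U" "\<gamma> t1 \<in> U" using balls k by auto
    then have "closed_segment (\<gamma> t0 \<bullet> u) (\<gamma> t1 \<bullet> u) \<subseteq> (\<lambda>z. z \<bullet> u) ` U"
      by (intro closed_segment_subset U) auto
    then show ?thesis using U(3) that by blast
  qed
  then have h: "(1 - l) * height (\<gamma> t0) + l * height (\<gamma> t1) \<le> m"
    using height_segment[of "\<gamma> t0" "\<gamma> t1" l] l r0 by metis
  \<comment> \<open>Strict at \<open>t0\<close>, since \<open>r0\<close> is the first time at the
    minimum; possibly an equality at \<open>t1\<close>. Concavity then forces \<open>l = 1\<close>,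
    so that \<open>\<gamma> t1\<close> equals \<open>\<gamma> r0\<close> after the last
    visit.\<close>
  have "m < height (\<gamma> t0)" "m \<le> height (\<gamma> t1)"
    using q(2)[OF t01(1)] q(2)[OF t01(2)] r0(3)[OF t01(1)] t01(3) unfolding m_def by force+
  then have "0 \<le> l * (height (\<gamma> t1) - m)" using l by simp
  moreover have "(1 - l) * (height (\<gamma> t0) - m) + l * (height (\<gamma> t1) - m) \<le> 0"
    using h by (simp add: algebra_simps)
  ultimately have "(1 - l) * (height (\<gamma> t0) - m) \<le> 0" by linarith
  then have "l = 1" using \<open>m < height (\<gamma> t0)\<close> l by (simp add: mult_le_0_iff)
  then show False using l r1(3)[OF t01(2)] t01(4) by simp
qed

text \<open>Of three times spent in \<open>e\<close>, the middle one lies on the chord of the outer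
  two and hence at one of its ends. So at most two points of \<open>e\<close> are visited, each
  during an interval of time, since a single point is a convex cell.\<close>

lemma interacts_finitely_if_chords:
  assumes sc: "shortest_curve X A B \<gamma>"
    and chord: "\<And>P Q. P \<in> e \<Longrightarrow> Q \<in> e \<Longrightarrow> closed_segment P Q \<subseteq> X \<and> closed_segment P Q \<inter> e \<subseteq> {P, Q}"
  shows "interacts_finitely \<gamma> e"
proof -
  let ?T = "{t \<in> {0..1}. \<gamma> t \<in> e}"
  have mid: "\<gamma> r \<in> {\<gamma> s, \<gamma> t}" if "s \<in> ?T" "r \<in> ?T" "t \<in> ?T" "s \<le> r" "r \<le> t" for s r t
  proof -
    have e: "\<gamma> s \<in> e" "\<gamma> r \<in> e" "\<gamma> t \<in> e" using that by auto
    have "\<gamma> r \<in> closed_segment (\<gamma> s) (\<gamma> t)"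
      using shortest_curve_chord[OF sc, of s r t] chord[OF e(1,3)] that by auto
    then show ?thesis using chord[OF e(1,3)] e by blast
  qed
  have "\<exists>a b. \<gamma> ` ?T \<subseteq> {a, b}"
  proof (rule ccontr)
    assume no: "\<not> ?thesis"
    then obtain q1 where q1: "q1 \<in> ?T" by blast
    obtain q2 where q2: "q2 \<in> ?T" "\<gamma> q2 \<noteq> \<gamma> q1" using no by blast
    obtain q3 where q3: "q3 \<in> ?T" "\<gamma> q3 \<noteq> \<gamma> q1" "\<gamma> q3 \<noteq> \<gamma> q2" using no by blast
    have "(q1 \<le> q2 \<and> q2 \<le> q3) \<or> (q1 \<le> q3 \<and> q3 \<le> q2) \<or> (q2 \<le> q1 \<and> q1 \<le> q3)
      \<or> (q2 \<le> q3 \<and> q3 \<le> q1) \<or> (q3 \<le> q1 \<and> q1 \<le> q2) \<or> (q3 \<le> q2 \<and> q2 \<le> q1)" by linarith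
    then show False
      using mid[of q1 q2 q3] mid[of q1 q3 q2] mid[of q2 q1 q3] mid[of q2 q3 q1] mid[of q3 q1 q2]
        mid[of q3 q2 q1] q1 q2 q3 by auto
  qed
  then have fin: "finite (\<gamma> ` ?T)" using finite_subset by blast
  have "?T = \<Union>((\<lambda>z. {t \<in> {0..1}. \<gamma> t \<in> {z}}) ` (\<gamma> ` ?T))" by auto
  moreover have "finite (components (\<Union>((\<lambda>z. {t \<in> {0..1}. \<gamma> t \<in> {z}}) ` (\<gamma> ` ?T))))"
  proof (rule finite_components_Union)
    fix C assume "C \<in> (\<lambda>z. {t \<in> {0..1}. \<gamma> t \<in> {z}}) ` (\<gamma> ` ?T)"
    then obtain z where z: "z \<in> e" "C = {t \<in> {0..1}. \<gamma> t \<in> {z}}" by blast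
    have "{z} \<subseteq> X" using chord[OF z(1) z(1)] by auto
    then show "connected C" using shortest_curve_convex_cell(2)[OF sc, of "{z}"] z by simp
  qed (use fin in simp)
  ultimately show ?thesis unfolding interacts_finitely_def by simp
qed

text \<open>The two bounds \<open>\<rho> / 2\<close> add up to \<open>\<rho>\<close>: a shortest
  curve between two points of the arc stays within \<open>\<rho> / 2\<close> of its start, which is
  itself within \<open>\<rho> / 2\<close> of the centre. The local hypotheses therefore apply along
  the whole curve.\<close>

lemma graph_arc_interacts_finitely:
  assumes sc: "shortest_curve X A B \<gamma>" and rho: "0 < \<rho>"
    and pos: "\<And>x. \<bar>x - z0 \<bullet> u\<bar> < \<rho> \<Longrightarrow> 0 < poly (pderiv (pderiv p)) x"
    and above: "(\<forall>z\<in>ball z0 \<rho>. 0 < height z \<longrightarrow> z \<in> X) \<or> (\<forall>z\<in>ball z0 \<rho>. 0 < height z \<longrightarrow> z \<notin> X)"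
    and below: "(\<forall>z\<in>ball z0 \<rho>. height z < 0 \<longrightarrow> z \<in> X) \<or> (\<forall>z\<in>ball z0 \<rho>. height z < 0 \<longrightarrow> z \<notin> X)"
    and e: "graph_point ` {a<..<b} \<subseteq> X" "graph_point ` {a<..<b} \<subseteq> ball z0 (\<rho> / 2)"
    and M: "\<And>x. x \<in> {a<..<b} \<Longrightarrow> norm (u + poly (pderiv p) x *\<^sub>R v) \<le> M" "M * (b - a) \<le> \<rho> / 2"
  shows "interacts_finitely \<gamma> (graph_point ` {a<..<b})"
proof -
  let ?e = "graph_point ` {a<..<b}"
  have e\<rho>: "?e \<subseteq> ball z0 \<rho>" using e(2) rho by force
  have near: "\<bar>z \<bullet> u - z0 \<bullet> u\<bar> < \<rho>" if "z \<in> ball z0 \<rho>" for z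
  proof -
    have "\<bar>(z - z0) \<bullet> u\<bar> \<le> norm (z - z0) * norm u" by (rule Cauchy_Schwarz_ineq2)
    also have "\<dots> = dist z0 z" using uu by (simp add: dist_norm norm_minus_commute norm_eq_sqrt_inner[of u])
    finally show ?thesis using that by (simp add: inner_diff_left)
  qed
  have posU: "0 < poly (pderiv (pderiv p)) x" if "x \<in> (\<lambda>z. z \<bullet> u) ` ball z0 \<rho>" for x
    using that near pos by blast
  have convU: "convex ((\<lambda>z. z \<bullet> u) ` ball z0 \<rho>)"
    by (intro convex_linear_image convex_ball bounded_linear.linear bounded_linear_inner_left)
  from above show ?thesis
  proof
    assume up: "\<forall>z\<in>ball z0 \<rho>. 0 < height z \<longrightarrow> z \<in> X"
    show ?thesis
    proof (rule interacts_finitely_if_chords[OF sc])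
      fix P Q assume PQ: "P \<in> ?e" "Q \<in> ?e"
      have ends: "height P = 0" "height Q = 0" using PQ by auto
      have inside: "closed_segment P Q \<subseteq> ball z0 \<rho>"
        by (rule closed_segment_subset) (use PQ e\<rho> in auto)
      have "closed_segment (P \<bullet> u) (Q \<bullet> u) \<subseteq> (\<lambda>z. z \<bullet> u) ` ball z0 \<rho>"
        by (rule closed_segment_subset[OF _ _ convU]) (use PQ e\<rho> in blast)+
      then have pos': "0 < poly (pderiv (pderiv p)) x" if "x \<in> closed_segment (P \<bullet> u) (Q \<bullet> u)" for x
        using that posU by blast
      have main: "z \<in> {P, Q} \<or> 0 < height z" if "z \<in> closed_segment P Q" for z
      proof -
        obtain l where l: "0 \<le> l" "l \<le> 1" "z = (1 - l) *\<^sub>R P + l *\<^sub>R Q"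
          using \<open>z \<in> closed_segment P Q\<close> unfolding in_segment by blast
        consider "l = 0" | "l = 1" | "P \<bullet> u = Q \<bullet> u" | "0 < l" "l < 1" "P \<bullet> u \<noteq> Q \<bullet> u"
          using l by force
        then show ?thesis
        proof cases
          case 3
          then have "P = Q" using graph_point_eq[OF ends(1)] graph_point_eq[OF ends(2)] by metis
          then show ?thesis using that by simp
        next
          case 4
          then show ?thesis using height_segment_strict[OF pos' 4] ends l by simp
        qed (use l in auto)
      qed
      have "closed_segment P Q \<subseteq> X"
        using main inside up PQ e(1) by blast
      moreover have "closed_segment P Q \<inter> ?e \<subseteq> {P, Q}"
      proof
        fix z assume z: "z \<in> closed_segment P Q \<inter> ?e"
        then have "height z = 0" by auto
        then show "z \<in> {P, Q}" using main[of z] z by simp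
      qed
      ultimately show "closed_segment P Q \<subseteq> X \<and> closed_segment P Q \<inter> ?e \<subseteq> {P, Q}" ..
    qed
  next
    assume up: "\<forall>z\<in>ball z0 \<rho>. 0 < height z \<longrightarrow> z \<notin> X"
    show ?thesis
    proof (rule interacts_finitely_if_interval(1))
      fix s r t assume st: "0 \<le> s" "s \<le> r" "r \<le> t" "t \<le> 1" and se: "\<gamma> s \<in> ?e" and te: "\<gamma> t \<in> ?e"
      show "\<gamma> r \<in> ?e"
      proof (cases "s = t")
        case True then show ?thesis using st se by auto
      next
        case False
        then have "s < t" using st by auto
        obtain x1 x2 where x: "x1 \<in> {a<..<b}" "\<gamma> s = graph_point x1" "x2 \<in> {a<..<b}" "\<gamma> t = graph_point x2"
          using se te by blast
        have seg: "closed_segment x1 x2 \<subseteq> {a<..<b}"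
          by (rule closed_segment_subset) (use x in auto)
        obtain \<eta> where \<eta>: "C2_on_interval s t \<eta>" "continuous_on {s..t} \<eta>"
            "\<eta> ` {s..t} \<subseteq> graph_point ` closed_segment x1 x2" "\<eta> s = graph_point x1"
            "\<eta> t = graph_point x2" "arc_length \<eta> s t \<le> M * \<bar>x2 - x1\<bar>"
          using graph_arc_length_le[OF \<open>s < t\<close>, of x1 x2 M] M(1) seg by blast
        have "0 \<le> M" using M(1)[OF x(1)] norm_ge_zero order_trans by blast
        then have "M * \<bar>x2 - x1\<bar> \<le> M * (b - a)"
          by (intro mult_left_mono) (use x in auto)
        moreover have "arc_length \<gamma> s t \<le> arc_length \<eta> s t"
          using shortest_curve_replace[OF sc st(1) \<open>s < t\<close> st(4) \<eta>(1,2)] \<eta> x seg e(1) by fastforce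
        ultimately have len: "arc_length \<gamma> s t \<le> \<rho> / 2" using \<eta> M(2) by linarith
        have X: "\<gamma> q \<in> X" if "q \<in> {s..t}" for q
          using sc that st unfolding shortest_curve_def curve_in_def by auto
        have inB: "\<gamma> q \<in> ball z0 \<rho>" if "q \<in> {s..t}" for q
        proof -
          have "dist (\<gamma> s) (\<gamma> q) \<le> \<rho> / 2"
          proof -
            have "dist (\<gamma> s) (\<gamma> q) + dist (\<gamma> q) (\<gamma> t) \<le> arc_length \<gamma> s t"
              using shortest_curve_dist_le[OF sc st(1), of q t] that st by auto
            then show ?thesis using len zero_le_dist[of "\<gamma> q" "\<gamma> t"] by linarith
          qed
          moreover have "dist z0 (\<gamma> s) < \<rho> / 2" using se e(2) by auto
          ultimately show ?thesis using dist_triangle[of z0 "\<gamma> q" "\<gamma> s"] by simp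
        qed
        have ends: "height (\<gamma> s) = 0" "height (\<gamma> t) = 0" using x by auto
        have le: "height (\<gamma> q) \<le> 0" if "q \<in> {s..t}" for q
          using up inB[OF that] X[OF that] by force
        have ge: "0 \<le> height (\<gamma> q)" if q: "q \<in> {s..t}" for q
          using below
        proof
          assume "\<forall>z\<in>ball z0 \<rho>. height z < 0 \<longrightarrow> z \<in> X"
          moreover have "\<gamma> ` {s..t} \<subseteq> ball z0 \<rho>" using inB by (rule image_subsetI)
          ultimately show ?thesis
            using shortest_curve_height_nonneg[OF sc st(1) _ _ st(4) open_ball convU posU _ _ ends, of q]
              q by auto
        next
          assume "\<forall>z\<in>ball z0 \<rho>. height z < 0 \<longrightarrow> z \<notin> X"
          then show ?thesis using inB[OF q] X[OF q] by (meson not_less)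
        qed
        have on: "height (\<gamma> q) = 0" if "q \<in> {s..t}" for q
          using le[OF that] ge[OF that] by simp
        \<comment> \<open>Lying on the graph does not yet mean lying on the arc; the abscissa must
          also stay between those of the two ends.\<close>
        then have "\<gamma> r \<bullet> u \<in> closed_segment x1 x2"
          using shortest_curve_on_graph_between[OF sc st, OF on] x by simp
        then have "graph_point (\<gamma> r \<bullet> u) \<in> ?e" using seg by blast
        then show ?thesis using graph_point_eq[OF on] st by simp
      qed
    qed
  qed
qed

end

section \<open>Countable decompositions\<close>

text \<open>The predicate on cells is a parameter, so that the same notion serves planar sets and
  sets of graph parameters; for the latter the predicate speaks of the image on the graph.\<close>

definition decomposable :: "('a set \<Rightarrow> bool) \<Rightarrow> 'a set \<Rightarrow> bool" where
  "decomposable P S \<longleftrightarrow> (\<exists>C. countable C \<and> disjoint C \<and> \<Union>C = S \<and> (\<forall>e\<in>C. P e))"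

lemma decomposable_single: "P e \<Longrightarrow> decomposable P e"
  unfolding decomposable_def by (intro exI[of _ "{e}"]) auto

lemma decomposable_Union:
  assumes "countable \<S>" "disjoint \<S>" "\<And>S. S \<in> \<S> \<Longrightarrow> decomposable P S"
  shows "decomposable P (\<Union>\<S>)"
proof -
  have "\<forall>S\<in>\<S>. \<exists>C. countable C \<and> disjoint C \<and> \<Union>C = S \<and> (\<forall>e\<in>C. P e)"
    using assms(3) unfolding decomposable_def by blast
  then obtain f where f: "\<forall>S\<in>\<S>. countable (f S) \<and> disjoint (f S) \<and> \<Union>(f S) = S \<and> (\<forall>e\<in>f S. P e)"
    by metis
  have "e \<inter> e' = {}" if e: "S \<in> \<S>" "S' \<in> \<S>" "e \<in> f S" "e' \<in> f S'" "e \<noteq> e'" for S S' e e'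
  proof (cases "S = S'")
    case True
    then show ?thesis using e f disjointD[of "f S" e e'] by simp
  next
    case False
    then have "S \<inter> S' = {}" using e disjointD[OF assms(2)] by simp
    moreover have "e \<subseteq> S" "e' \<subseteq> S'" using e f by auto
    ultimately show ?thesis by auto
  qed
  then have "disjoint (\<Union>(f ` \<S>))" by (intro disjointI) (elim UN_E, simp)
  moreover have "countable (\<Union>(f ` \<S>))" using assms(1) f by auto
  moreover have "\<Union>(\<Union>(f ` \<S>)) = (\<Union>S\<in>\<S>. \<Union>(f S))" by auto
  then have "\<Union>(\<Union>(f ` \<S>)) = \<Union>\<S>" using f by simp
  moreover have "\<forall>e\<in>\<Union>(f ` \<S>). P e" using f by auto
  ultimately show ?thesis unfolding decomposable_def by (intro exI[of _ "\<Union>(f ` \<S>)"]) simp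
qed

lemma decomposable_Un:
  assumes "decomposable P S" "decomposable P T" "S \<inter> T = {}"
  shows "decomposable P (S \<union> T)"
proof -
  have "decomposable P (\<Union>{S,T})"
    by (rule decomposable_Union) (use assms in \<open>auto simp: disjoint_def\<close>)
  then show ?thesis by simp
qed

lemma decomposable_countable:
  assumes "countable S" "\<And>x. x \<in> S \<Longrightarrow> P {x}"
  shows "decomposable P S"
proof -
  have "decomposable P (\<Union>((\<lambda>x. {x}) ` S))"
    by (rule decomposable_Union) (use assms in \<open>auto simp: disjoint_def intro: decomposable_single\<close>)
  then show ?thesis by simp
qed

lemma decomposable_image:
  assumes "decomposable (\<lambda>e. P (c ` e)) S" "inj c"
  shows "decomposable P (c ` S)"
proof -
  obtain C where C: "countable C" "disjoint C" "\<Union>C = S" "\<forall>e\<in>C. P (c ` e)"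
    using assms(1) unfolding decomposable_def by blast
  have "disjoint ((`) c ` C)"
    using C(2) assms(2) unfolding disjoint_def by (auto simp: image_Int[symmetric])
  moreover have "\<Union>((`) c ` C) = c ` S" using C(3) by auto
  ultimately show ?thesis
    unfolding decomposable_def using C by (intro exI[of _ "(`) c ` C"]) auto
qed

text \<open>Each point picks the first cell of its nested chain that satisfies the property; two such
  cells that meet are equal.\<close>

lemma decomposable_first_cells:
  fixes D :: "nat \<Rightarrow> 'a \<Rightarrow> 'a set"
  assumes mem: "\<And>n z. z \<in> D n z"
    and eq: "\<And>n y z. y \<in> D n z \<Longrightarrow> D n y = D n z"
    and dec: "\<And>n z. D (Suc n) z \<subseteq> D n z"
    and cnt: "\<And>n. countable (range (D n))"
    and ex: "\<And>z. z \<in> G \<Longrightarrow> \<exists>n. D n z \<subseteq> G \<and> decomposable Q (D n z)"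
  shows "decomposable Q G"
proof -
  define P where "P S \<longleftrightarrow> S \<subseteq> G \<and> decomposable Q S" for S
  define N where "N z = (LEAST n. P (D n z))" for z
  define \<S> where "\<S> = (\<lambda>z. D (N z) z) ` G"
  have PN: "P (D (N z) z)" if "z \<in> G" for z
    unfolding N_def unfolding P_def using ex[OF that] by (rule LeastI_ex)
  have mono: "D n z \<subseteq> D m z" if "m \<le> n" for m n z
    using that dec by (rule lift_Suc_antimono_le[rotated])
  \<comment> \<open>Up to level \<open>N z\<close> the cells of \<open>y\<close> and
    \<open>z\<close> agree, so \<open>y\<close> succeeds at that level and at no earlier one. Chosen
    cells that meet therefore have the same level.\<close>
  have same: "N y = N z" if z: "z \<in> G" and y: "y \<in> D (N z) z" for y z
    unfolding N_def[of y]
  proof (rule Least_equality)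
    show "P (D (N z) y)" using eq[OF y] PN[OF z] by simp
    fix n assume n: "P (D n y)"
    show "N z \<le> n"
    proof (rule ccontr)
      assume "\<not> N z \<le> n"
      then have "D n y = D n z" using y mono[of n "N z" z] eq[of y n z] by auto
      then have "P (D n z)" using n by simp
      then show False using \<open>\<not> N z \<le> n\<close> unfolding N_def by (simp add: Least_le)
    qed
  qed
  have "\<S> \<subseteq> (\<Union>n. range (D n))" unfolding \<S>_def by auto
  then have 1: "countable \<S>" by (rule countable_subset) (simp add: cnt)
  have 2: "disjoint \<S>"
  proof (rule disjointI)
    fix S T assume "S \<in> \<S>" "T \<in> \<S>" "S \<noteq> T"
    then obtain z w where zw: "z \<in> G" "w \<in> G" "S = D (N z) z" "T = D (N w) w"
      unfolding \<S>_def by blast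
    show "S \<inter> T = {}"
    proof (rule ccontr)
      assume "S \<inter> T \<noteq> {}"
      then obtain y where "y \<in> D (N z) z" "y \<in> D (N w) w" using zw by auto
      then have "D (N z) z = D (N w) w" using same eq zw(1,2) by metis
      then show False using zw \<open>S \<noteq> T\<close> by simp
    qed
  qed
  have "\<Union>\<S> = G" unfolding \<S>_def using PN mem unfolding P_def by blast
  moreover have "decomposable Q (\<Union>\<S>)"
    by (rule decomposable_Union[OF 1 2]) (use PN in \<open>auto simp: \<S>_def P_def\<close>)
  ultimately show ?thesis by simp
qed

section \<open>Dyadic subdivision of open sets\<close>

text \<open>The half-open dyadic interval of length \<open>1 / 2 ^ n\<close> around
  \<open>x\<close>, labelled by a floor: sharing a label is an equivalence, and the labels are
  integers, so intervals of one level are equal or disjoint and countably many.\<close>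

definition dyadic_interval :: "nat \<Rightarrow> real \<Rightarrow> real set" where
  "dyadic_interval n x = {y. \<lfloor>2 ^ n * y\<rfloor> = \<lfloor>2 ^ n * x\<rfloor>}"

lemma dyadic_interval_eq:
  "dyadic_interval n x = {of_int \<lfloor>2 ^ n * x\<rfloor> / 2 ^ n ..< (of_int \<lfloor>2 ^ n * x\<rfloor> + 1) / 2 ^ n}"
  unfolding dyadic_interval_def by (auto simp: floor_eq_iff field_simps)

lemma dyadic_interval_obtain:
  obtains a b where "dyadic_interval n x = {a..<b}" "a < b" "b - a = 1 / 2 ^ n"
  using dyadic_interval_eq[of n x] by (auto simp: field_simps)

lemma dyadic_interval_self: "x \<in> dyadic_interval n x"
  unfolding dyadic_interval_def by simp

lemma dyadic_interval_cong: "y \<in> dyadic_interval n x \<Longrightarrow> dyadic_interval n y = dyadic_interval n x"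
  unfolding dyadic_interval_def by simp

lemma dyadic_interval_Suc: "dyadic_interval (Suc n) x \<subseteq> dyadic_interval n x"
proof -
  \<comment> \<open>The coarser label is the integer half of the finer one, which gives
    nesting.\<close>
  have "\<lfloor>2 ^ n * y\<rfloor> = \<lfloor>2 ^ Suc n * y\<rfloor> div 2" for y :: real
    using floor_divide_real_eq_div[of 2 "2 ^ Suc n * y"] by simp
  then show ?thesis unfolding dyadic_interval_def by auto
qed

lemma countable_dyadic_intervals: "countable (range (dyadic_interval n))"
proof -
  have "range (dyadic_interval n) \<subseteq> range (\<lambda>k::int. {y. \<lfloor>2 ^ n * y\<rfloor> = k})"
    unfolding dyadic_interval_def by auto
  then show ?thesis by (rule countable_subset) simp
qed

lemma dyadic_scale:
  fixes e :: real
  assumes "0 < e"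
  obtains n where "1 / 2 ^ n < e"
  using real_arch_pow_inv[OF assms, of "1/2"] by (auto simp: power_one_over)

lemma decomposable_open_real:
  fixes G :: "real set"
  assumes "open G" "\<And>x. x \<in> G \<Longrightarrow> P {x}"
    and loc: "\<And>x. x \<in> G \<Longrightarrow> \<exists>\<delta>>0. \<forall>a b. x - \<delta> < a \<longrightarrow> a < b \<longrightarrow> b < x + \<delta> \<longrightarrow> P {a<..<b}"
  shows "decomposable P G"
proof -
  have "\<exists>n. dyadic_interval n x \<subseteq> G \<and> decomposable P (dyadic_interval n x)" if x: "x \<in> G" for x
  proof -
    obtain r where r: "0 < r" "ball x r \<subseteq> G" using assms(1) x open_contains_ball by blast
    obtain \<delta> where d: "\<delta> > 0" "\<forall>a b. x - \<delta> < a \<longrightarrow> a < b \<longrightarrow> b < x + \<delta> \<longrightarrow> P {a<..<b}"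
      using loc[OF x] by blast
    obtain n where n: "1 / 2 ^ n < min r \<delta>" using dyadic_scale[of "min r \<delta>"] r d by auto
    obtain a b where ab: "dyadic_interval n x = {a..<b}" "a < b" "b - a = 1 / 2 ^ n"
      by (rule dyadic_interval_obtain)
    have x': "a \<le> x" "x < b" using dyadic_interval_self[of x n] ab by auto
    have G: "{a..<b} \<subseteq> G"
    proof
      fix y assume "y \<in> {a..<b}"
      then have "y \<in> ball x r" using x' ab n by (auto simp: dist_real_def)
      then show "y \<in> G" using r by blast
    qed
    \<comment> \<open>The half-open interval is split into its left end point and an open interval,
      each of which satisfies \<open>P\<close>.\<close>
    have "P {a<..<b}" using d x' ab n by auto
    moreover have "P {a}" using assms(2) G ab by auto
    ultimately have "decomposable P ({a} \<union> {a<..<b})"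
      by (intro decomposable_Un decomposable_single) auto
    moreover have "{a} \<union> {a<..<b} = {a..<b}" using ab(2) by auto
    ultimately have "dyadic_interval n x \<subseteq> G \<and> decomposable P (dyadic_interval n x)"
      using G ab(1) by simp
    then show ?thesis ..
  qed
  from decomposable_first_cells[of dyadic_interval, OF dyadic_interval_self dyadic_interval_cong
      dyadic_interval_Suc countable_dyadic_intervals this]
  show ?thesis .
qed

lemma decomposable_open_plane:
  fixes G :: "(real \<times> real) set"
  assumes "open G" "\<And>a b. (a, b) \<in> G \<Longrightarrow> P {(a, b)}"
    and "\<And>a b c. a < b \<Longrightarrow> {a<..<b} \<times> {c} \<subseteq> G \<Longrightarrow> P ({a<..<b} \<times> {c})"
    and "\<And>a c d. c < d \<Longrightarrow> {a} \<times> {c<..<d} \<subseteq> G \<Longrightarrow> P ({a} \<times> {c<..<d})"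
    and "\<And>a b c d. a < b \<Longrightarrow> c < d \<Longrightarrow> {a<..<b} \<times> {c<..<d} \<subseteq> G \<Longrightarrow> P ({a<..<b} \<times> {c<..<d})"
  shows "decomposable P G"
proof -
  define D where "D n z = dyadic_interval n (fst z) \<times> dyadic_interval n (snd z)"
    for n and z :: "real \<times> real"
  have "\<exists>n. D n z \<subseteq> G \<and> decomposable P (D n z)" if z: "z \<in> G" for z
  proof -
    obtain r where r: "0 < r" "ball z r \<subseteq> G" using assms(1) z open_contains_ball by blast
    \<comment> \<open>Half of \<open>r\<close>, because a distance in the plane is estimated by the
      sum of the two coordinate distances.\<close>
    obtain n where n: "1 / 2 ^ n < r / 2" using dyadic_scale[of "r / 2"] r by auto
    obtain a b where ab: "dyadic_interval n (fst z) = {a..<b}" "a < b" "b - a = 1 / 2 ^ n"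
      by (rule dyadic_interval_obtain)
    obtain c d where cd: "dyadic_interval n (snd z) = {c..<d}" "c < d" "d - c = 1 / 2 ^ n"
      by (rule dyadic_interval_obtain)
    have z': "a \<le> fst z" "fst z < b" "c \<le> snd z" "snd z < d"
      using dyadic_interval_self[of "fst z" n] dyadic_interval_self[of "snd z" n] ab cd by auto
    have G: "{a..<b} \<times> {c..<d} \<subseteq> G"
    proof
      fix y assume y: "y \<in> {a..<b} \<times> {c..<d}"
      have "norm (z - y) \<le> norm (fst (z - y)) + norm (snd (z - y))"
        using norm_Pair_le[of "fst (z - y)" "snd (z - y)"] by (simp only: prod.collapse)
      also have "\<dots> < r" using y z' ab cd n by (auto simp: mem_Times_iff)
      finally have "y \<in> ball z r" by (simp add: dist_norm)
      then show "y \<in> G" using r by blast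
    qed
    \<comment> \<open>A half-open square consists of its interior, its open lower and left edges,
      and its lower left corner.\<close>
    have "P ({a<..<b} \<times> {c<..<d})" "P ({a<..<b} \<times> {c})" "P ({a} \<times> {c<..<d})" "P {(a, c)}"
      by (rule assms(5) assms(3) assms(4) assms(2); use G ab cd in \<open>force simp: subset_iff\<close>)+
    then have "decomposable P ({a<..<b} \<times> {c<..<d} \<union> {a<..<b} \<times> {c} \<union> {a} \<times> {c<..<d} \<union> {(a, c)})"
      by (intro decomposable_Un) (auto intro: decomposable_single)
    moreover have "{a<..<b} \<times> {c<..<d} \<union> {a<..<b} \<times> {c} \<union> {a} \<times> {c<..<d} \<union> {(a, c)}
        = {a..<b} \<times> {c..<d}"
      using ab(2) cd(2) by auto
    ultimately have "D n z \<subseteq> G \<and> decomposable P (D n z)"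
      using G ab(1) cd(1) unfolding D_def by simp
    then show ?thesis ..
  qed
  moreover have "countable (range (D n))" for n
  proof -
    have "range (D n) \<subseteq> (\<lambda>(S,T). S \<times> T) ` (range (dyadic_interval n) \<times> range (dyadic_interval n))"
      unfolding D_def by auto
    then show ?thesis
      by (rule countable_subset) (intro countable_image countable_SIGMA countable_dyadic_intervals)
  qed
  moreover have "z \<in> D n z" "D (Suc n) z \<subseteq> D n z" "y \<in> D n z \<Longrightarrow> D n y = D n z" for n y z
    unfolding D_def
    using dyadic_interval_self dyadic_interval_cong[of "fst y" n "fst z"]
      dyadic_interval_cong[of "snd y" n "snd z"]
    by (auto simp: mem_Times_iff intro: subsetD[OF dyadic_interval_Suc])
  ultimately show ?thesis by (intro decomposable_first_cells[of D]) simp_all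
qed

section \<open>Sets determined by the signs of polynomial half planes\<close>

definition fine_cell :: "(real \<times> real) set \<Rightarrow> (real \<times> real) set \<Rightarrow> bool" where
  "fine_cell X e \<longleftrightarrow> is_cell e \<and> e \<subseteq> X \<and>
     (\<forall>A B \<gamma>. shortest_curve X A B \<gamma> \<longrightarrow> interacts_finitely \<gamma> e)"

lemma fine_cell_convex: "is_cell e \<Longrightarrow> convex e \<Longrightarrow> e \<subseteq> X \<Longrightarrow> fine_cell X e"
  unfolding fine_cell_def using shortest_curve_convex_cell(1) by simp

lemma fine_cell_point: "z \<in> X \<Longrightarrow> fine_cell X {z}"
  by (rule fine_cell_convex) (auto simp: is_cell_def)

lemma is_cell_rectangle:
  "a < b \<Longrightarrow> is_cell ({a<..<b} \<times> {c})"
  "c < d \<Longrightarrow> is_cell ({a} \<times> {c<..<d})"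
  "a < b \<Longrightarrow> c < d \<Longrightarrow> is_cell ({a<..<b} \<times> {c<..<d})"
proof -
  assume "a < b"
  have "homeomorphism ({a<..<b} \<times> {c}) {a<..<b} fst (\<lambda>x. (x, c))"
    by (rule homeomorphismI) (auto intro!: continuous_intros)
  then have "({a<..<b} \<times> {c}) homeomorphic {a<..<b}" unfolding homeomorphic_def by (intro exI)
  from homeomorphic_trans[OF this homeomorphic_open_interval_UNIV[OF \<open>a < b\<close>]]
  show "is_cell ({a<..<b} \<times> {c})" unfolding is_cell_def by simp
next
  assume "c < d"
  have "homeomorphism ({a} \<times> {c<..<d}) {c<..<d} snd (\<lambda>y. (a, y))"
    by (rule homeomorphismI) (auto intro!: continuous_intros)
  then have "({a} \<times> {c<..<d}) homeomorphic {c<..<d}" unfolding homeomorphic_def by (intro exI)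
  from homeomorphic_trans[OF this homeomorphic_open_interval_UNIV[OF \<open>c < d\<close>]]
  show "is_cell ({a} \<times> {c<..<d})" unfolding is_cell_def by simp
next
  assume "a < b" "c < d"
  have box: "box (a, c) (b, d) = {a<..<b} \<times> {c<..<d}"
    by (auto simp: box_def Basis_prod_def ball_Un)
  have "(a + b) / 2 \<in> {a<..<b}" "(c + d) / 2 \<in> {c<..<d}" using \<open>a < b\<close> \<open>c < d\<close> by auto
  then have "box (a, c) (b, d) \<noteq> {}" unfolding box by blast
  then have "box (a, c) (b, d) homeomorphic (UNIV :: (real \<times> real) set)"
    by (rule homeomorphic_box_UNIV)
  then show "is_cell ({a<..<b} \<times> {c<..<d})" unfolding is_cell_def box by simp
qed

lemma decomposable_open_subset:
  assumes "open G" "G \<subseteq> X"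
  shows "decomposable (fine_cell X) G"
  by (rule decomposable_open_plane[OF assms(1)])
     (use assms(2) in \<open>auto intro!: fine_cell_convex fine_cell_point is_cell_rectangle convex_Times\<close>)

section \<open>Fine arcs of a single graph\<close>

context polynomial_graph
begin

lemma fine_arcs_strictly_convex:
  assumes R: "0 < R"
    and pos: "0 < poly (pderiv (pderiv p)) x0"
    and on: "\<forall>z\<in>ball (graph_point x0) R. height z = 0 \<longrightarrow> z \<in> X"
    and above: "(\<forall>z\<in>ball (graph_point x0) R. 0 < height z \<longrightarrow> z \<in> X)
      \<or> (\<forall>z\<in>ball (graph_point x0) R. 0 < height z \<longrightarrow> z \<notin> X)"
    and below: "(\<forall>z\<in>ball (graph_point x0) R. height z < 0 \<longrightarrow> z \<in> X)
      \<or> (\<forall>z\<in>ball (graph_point x0) R. height z < 0 \<longrightarrow> z \<notin> X)"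
  shows "\<exists>\<delta>>0. \<forall>a b. x0 - \<delta> < a \<longrightarrow> a < b \<longrightarrow> b < x0 + \<delta> \<longrightarrow> fine_cell X (graph_point ` {a<..<b})"
proof -
  let ?z = "graph_point x0"
  have "open {x. 0 < poly (pderiv (pderiv p)) x}"
    by (intro open_Collect_less continuous_intros)
  then obtain r where r: "0 < r" "ball x0 r \<subseteq> {x. 0 < poly (pderiv (pderiv p)) x}"
    using pos open_contains_ball by blast
  define \<rho> where "\<rho> = min r R"
  have \<rho>: "0 < \<rho>" "\<rho> \<le> R" "\<rho> \<le> r" using r R unfolding \<rho>_def by auto
  have "compact ((\<lambda>x. norm (u + poly (pderiv p) x *\<^sub>R v)) ` {x0 - 1..x0 + 1})"
    by (intro compact_continuous_image continuous_intros) auto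
  then have "bounded ((\<lambda>x. norm (u + poly (pderiv p) x *\<^sub>R v)) ` {x0 - 1..x0 + 1})"
    by (rule compact_imp_bounded)
  then obtain M where M: "0 < M" "\<forall>y\<in>(\<lambda>x. norm (u + poly (pderiv p) x *\<^sub>R v)) ` {x0 - 1..x0 + 1}. norm y \<le> M"
    unfolding bounded_pos by blast
  have "open (graph_point -` ball ?z (\<rho> / 2))"
    by (rule open_vimage[OF open_ball continuous_on_graph_point])
  moreover have "x0 \<in> graph_point -` ball ?z (\<rho> / 2)" using \<rho> by simp
  ultimately obtain d where d: "0 < d" "ball x0 d \<subseteq> graph_point -` ball ?z (\<rho> / 2)"
    using open_contains_ball by blast
  \<comment> \<open>The bound \<open>1\<close> keeps the arc where \<open>M\<close> bounds the
    speed, \<open>d\<close> keeps it in the ball of half radius, and \<open>\<rho> / (4 * M)\<close>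
    makes \<open>M * (b - a)\<close> at most \<open>\<rho> / 2\<close>, as \<open>b - a\<close> is
    less than \<open>2 * \<delta>\<close>.\<close>
  define \<delta> where "\<delta> = min 1 (min d (\<rho> / (4 * M)))"
  have \<delta>: "0 < \<delta>" "\<delta> \<le> 1" "\<delta> \<le> d" "\<delta> \<le> \<rho> / (4 * M)" using d \<rho> M unfolding \<delta>_def by auto
  have "fine_cell X (graph_point ` {a<..<b})" if ab: "x0 - \<delta> < a" "a < b" "b < x0 + \<delta>" for a b
  proof -
    have "{a<..<b} \<subseteq> ball x0 d" using ab \<delta> by (auto simp: dist_real_def)
    then have in_ball: "graph_point ` {a<..<b} \<subseteq> ball ?z (\<rho> / 2)" using d by blast
    have in_X: "graph_point ` {a<..<b} \<subseteq> X"
    proof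
      fix w assume w: "w \<in> graph_point ` {a<..<b}"
      then have "w \<in> ball ?z R" using in_ball \<rho> by force
      then show "w \<in> X" using on w by auto
    qed
    have Mx: "norm (u + poly (pderiv p) x *\<^sub>R v) \<le> M" if "x \<in> {a<..<b}" for x
    proof -
      have "x \<in> {x0 - 1..x0 + 1}" using that ab \<delta> by auto
      then show ?thesis using M(2) by simp
    qed
    have "b - a \<le> 2 * (\<rho> / (4 * M))" using ab \<delta> by linarith
    then have "M * (b - a) \<le> M * (2 * (\<rho> / (4 * M)))" using M by (intro mult_left_mono) auto
    also have "\<dots> = \<rho> / 2" using M by simp
    finally have Mab: "M * (b - a) \<le> \<rho> / 2" .
    have pos': "0 < poly (pderiv (pderiv p)) x" if "\<bar>x - ?z \<bullet> u\<bar> < \<rho>" for x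
    proof -
      have "x \<in> ball x0 r" using that \<rho> by (auto simp: dist_real_def)
      then show ?thesis using r by blast
    qed
    have sub: "ball ?z \<rho> \<subseteq> ball ?z R" using \<rho> by auto
    have "interacts_finitely \<gamma> (graph_point ` {a<..<b})" if "shortest_curve X A B \<gamma>" for A B \<gamma>
      by (rule graph_arc_interacts_finitely[OF that \<rho>(1) pos' _ _ in_X in_ball Mx Mab])
         (use above below sub in blast)+
    then show ?thesis
      unfolding fine_cell_def using graph_arc_is_cell[OF ab(2)] in_X by blast
  qed
  then show ?thesis using \<delta>(1) by blast
qed

text \<open>With constant slope the arc is an affine image of an interval, hence itself a convex
  cell.\<close>

lemma fine_cell_linear:
  assumes "pderiv (pderiv p) = 0" "a < b" "graph_point ` {a<..<b} \<subseteq> X"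
  shows "fine_cell X (graph_point ` {a<..<b})"
proof -
  have "degree (pderiv p) = 0" using assms(1) by (simp add: pderiv_eq_0_iff)
  then obtain k where k: "pderiv p = [:k:]" by (rule degree_eq_zeroE)
  have lin: "poly p x = poly p 0 + x * k" for x
  proof -
    consider "x < 0" | "x = 0" | "0 < x" by linarith
    then show ?thesis
      by cases (use poly_MVT[of x 0 p] poly_MVT[of 0 x p] k in auto)
  qed
  have "graph_point x = poly p 0 *\<^sub>R v + x *\<^sub>R (u + k *\<^sub>R v)" for x
    unfolding graph_point_def lin[of x] by (simp add: algebra_simps)
  then have "graph_point ` {a<..<b}
      = (+) (poly p 0 *\<^sub>R v) ` ((\<lambda>x. x *\<^sub>R (u + k *\<^sub>R v)) ` {a<..<b})"
    by (simp add: image_image)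
  moreover have "convex ((\<lambda>x. x *\<^sub>R (u + k *\<^sub>R v)) ` {a<..<b})"
    by (intro convex_linear_image bounded_linear.linear bounded_linear_scaleR_left) simp
  ultimately have "convex (graph_point ` {a<..<b})" using convex_translation by metis
  then show ?thesis using fine_cell_convex graph_arc_is_cell assms by blast
qed

text \<open>In the frame with \<open>v\<close> reversed, \<open>- p\<close> describes the same
  points while \<open>height\<close> changes sign. The concave case becomes the convex one with the
  two sides exchanged.\<close>

lemma flip: "polynomial_graph u (- v)"
proof
  show "z = (z \<bullet> u) *\<^sub>R u + (z \<bullet> (- v)) *\<^sub>R (- v)" for z using frame[of z] by simp
qed (use uu vv uv in auto)

lemma flip_graph_point: "polynomial_graph.graph_point u (- v) (- p) = graph_point"
  unfolding polynomial_graph.graph_point_def[OF flip] graph_point_def by (simp add: fun_eq_iff)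

lemma flip_height: "polynomial_graph.height u (- v) (- p) z = - height z"
  unfolding polynomial_graph.height_def[OF flip] height_def by simp

lemma fine_arcs:
  assumes R: "0 < R"
    and curved: "poly (pderiv (pderiv p)) x0 \<noteq> 0 \<or> pderiv (pderiv p) = 0"
    and on: "\<forall>z\<in>ball (graph_point x0) R. height z = 0 \<longrightarrow> z \<in> X"
    and above: "(\<forall>z\<in>ball (graph_point x0) R. 0 < height z \<longrightarrow> z \<in> X)
      \<or> (\<forall>z\<in>ball (graph_point x0) R. 0 < height z \<longrightarrow> z \<notin> X)"
    and below: "(\<forall>z\<in>ball (graph_point x0) R. height z < 0 \<longrightarrow> z \<in> X)
      \<or> (\<forall>z\<in>ball (graph_point x0) R. height z < 0 \<longrightarrow> z \<notin> X)"
  shows "\<exists>\<delta>>0. \<forall>a b. x0 - \<delta> < a \<longrightarrow> a < b \<longrightarrow> b < x0 + \<delta> \<longrightarrow> fine_cell X (graph_point ` {a<..<b})"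
proof -
  consider "0 < poly (pderiv (pderiv p)) x0" | "poly (pderiv (pderiv p)) x0 < 0" | "pderiv (pderiv p) = 0"
    using curved by linarith
  then show ?thesis
  proof cases
    case 1
    then show ?thesis using fine_arcs_strictly_convex[OF R _ on above below] by blast
  next
    case 2
    then show ?thesis
      using polynomial_graph.fine_arcs_strictly_convex[OF flip R, of "- p" x0 X] on above below
      unfolding flip_graph_point flip_height by (simp add: pderiv_minus)
  next
    case 3
    have "open (graph_point -` ball (graph_point x0) R)"
      by (rule open_vimage[OF open_ball continuous_on_graph_point])
    moreover have "x0 \<in> graph_point -` ball (graph_point x0) R" using R by simp
    ultimately obtain d where d: "0 < d" "ball x0 d \<subseteq> graph_point -` ball (graph_point x0) R"
      using open_contains_ball by blast
    have "fine_cell X (graph_point ` {a<..<b})" if ab: "x0 - d < a" "a < b" "b < x0 + d" for a b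
    proof (rule fine_cell_linear[OF 3 ab(2)])
      have "{a<..<b} \<subseteq> ball x0 d" using ab by (auto simp: dist_real_def)
      then have "graph_point ` {a<..<b} \<subseteq> ball (graph_point x0) R" using d by blast
      then show "graph_point ` {a<..<b} \<subseteq> X" using on by auto
    qed
    then show ?thesis using d(1) by blast
  qed
qed

text \<open>The shear with coordinates abscissa and height turns each side into the product of a
  line and a ray.\<close>

lemma connected_side: "connected {z. 0 < height z}" "connected {z. height z < 0}"
proof -
  have eq: "{z. height z \<in> S} = (\<lambda>(x, h). graph_point x + h *\<^sub>R v) ` (UNIV \<times> S)" for S
  proof -
    have h: "height (graph_point x + h *\<^sub>R v) = h" for x h
      unfolding height_def using vv uv by (simp add: inner_add_left inner_commute[of v u])
    have "z = graph_point (z \<bullet> u) + height z *\<^sub>R v" for z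
      unfolding graph_point_def height_def using frame[of z] by (simp add: algebra_simps)
    then show ?thesis using h by force
  qed
  have "connected {z. height z \<in> S}" if "convex S" for S
    unfolding eq
    by (intro connected_continuous_image convex_connected convex_Times that convex_UNIV)
       (auto simp: case_prod_unfold graph_point_def intro!: continuous_intros)
  from this[of "{0<..}"] this[of "{..<0}"]
  show "connected {z. 0 < height z}" "connected {z. height z < 0}" by auto
qed

end

section \<open>Rotated frames and coinciding zero curves\<close>

lemma frame_graph: "polynomial_graph (cos \<theta>, sin \<theta>) (- sin \<theta>, cos \<theta>)"
proof unfold_locales
  show "(cos \<theta>, sin \<theta>) \<bullet> (cos \<theta>, sin \<theta>) = 1" "(- sin \<theta>, cos \<theta>) \<bullet> (- sin \<theta>, cos \<theta>) = 1"
    "(cos \<theta>, sin \<theta>) \<bullet> (- sin \<theta>, cos \<theta>) = 0"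
    using sin_cos_squared_add[of \<theta>] by (simp_all add: power2_eq_square)
  fix z :: "real \<times> real"
  obtain x y where z: "z = (x, y)" by fastforce
  have "x = (x * cos \<theta> + y * sin \<theta>) * cos \<theta> - (y * cos \<theta> - x * sin \<theta>) * sin \<theta>"
    "y = (x * cos \<theta> + y * sin \<theta>) * sin \<theta> + (y * cos \<theta> - x * sin \<theta>) * cos \<theta>"
    using sin_cos_squared_add[of \<theta>] by algebra+
  then show "z = (z \<bullet> (cos \<theta>, sin \<theta>)) *\<^sub>R (cos \<theta>, sin \<theta>) + (z \<bullet> (- sin \<theta>, cos \<theta>)) *\<^sub>R (- sin \<theta>, cos \<theta>)"
    unfolding z by simp
qed

global_interpretation rotated: polynomial_graph "(cos \<theta>, sin \<theta>)" "(- sin \<theta>, cos \<theta>)" p for \<theta> p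
  defines rotated_point = rotated.graph_point
  by (rule frame_graph)

lemma rotated_height: "rotated.height \<theta> p z = - Phi p \<theta> z"
  unfolding rotated.height_def Phi_def by (cases z) simp

lemma Phi_rotated_point [simp]: "Phi p \<theta> (rotated_point \<theta> p x) = 0"
  using rotated.height_graph_point[of \<theta> p x] by (simp add: rotated_height)

lemma rotated_point_eq:
  assumes "Phi p \<theta> z = 0"
  shows "rotated_point \<theta> p (z \<bullet> (cos \<theta>, sin \<theta>)) = z"
  using rotated.graph_point_eq[of \<theta> p z] assms by (simp add: rotated_height)

lemma continuous_on_Phi: "continuous_on S (Phi p \<theta>)"
  unfolding Phi_def by (intro continuous_intros)

lemma connected_Phi_side: "connected {z. Phi p \<theta> z < 0}" "connected {z. 0 < Phi p \<theta> z}"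
  using rotated.connected_side[of \<theta> p] by (simp_all add: rotated_height)

text \<open>Both coordinates of a graph point in any other frame are polynomials in the parameter.
  Hence another zero curve either meets the graph finitely often or contains it.\<close>

lemma Phi_along_graph:
  obtains f where "\<And>x. Phi q \<phi> (rotated_point \<theta> p x) = poly f x"
proof
  let ?A = "[:0, cos \<theta>:] - smult (sin \<theta>) p" and ?B = "[:0, sin \<theta>:] + smult (cos \<theta>) p"
  show "Phi q \<phi> (rotated_point \<theta> p x) = poly (pcompose q (smult (cos \<phi>) ?A + smult (sin \<phi>) ?B)
      - (smult (cos \<phi>) ?B - smult (sin \<phi>) ?A)) x" for x
    unfolding Phi_def rotated.graph_point_def
    by (simp add: poly_pcompose algebra_simps)
qed

text \<open>One graph contained in another, possibly in a different frame, is all of it: the second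
  graph then has infinitely many points on the first, so the polynomial that
  \<open>Phi p \<theta>\<close> becomes along it is zero.\<close>

lemma Phi_coincide:
  assumes sub: "\<And>x. Phi q \<phi> (rotated_point \<theta> p x) = 0"
  shows "Phi q \<phi> z = 0 \<longleftrightarrow> Phi p \<theta> z = 0"
proof
  assume "Phi p \<theta> z = 0"
  then show "Phi q \<phi> z = 0" using sub rotated_point_eq by metis
next
  assume z: "Phi q \<phi> z = 0"
  obtain f where f: "\<And>y. Phi p \<theta> (rotated_point \<phi> q y) = poly f y"
    using Phi_along_graph by blast
  \<comment> \<open>The abscissa of the same point in the second frame. It is injective in
    \<open>x\<close>, because a point of either graph is recovered from its abscissa.\<close>
  define k where "k x = rotated_point \<theta> p x \<bullet> (cos \<phi>, sin \<phi>)" for x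
  have k: "rotated_point \<phi> q (k x) = rotated_point \<theta> p x" for x
    unfolding k_def using rotated_point_eq[OF sub] .
  have "inj k"
  proof (rule injI)
    fix x y assume "k x = k y"
    then have "rotated_point \<theta> p x = rotated_point \<theta> p y" using k by metis
    then show "x = y" using rotated.inj_graph_point by (auto dest: injD)
  qed
  then have "infinite (range k)" by (simp add: finite_image_iff infinite_UNIV_char_0)
  moreover have "range k \<subseteq> {y. poly f y = 0}" using f k by (metis (mono_tags) Phi_rotated_point image_subsetI mem_Collect_eq)
  ultimately have "f = 0" using poly_roots_finite finite_subset by blast
  then show "Phi p \<theta> z = 0" using f rotated_point_eq[OF z] by (metis poly_0)
qed

lemma sgn_constant_on_connected:
  fixes f :: "'a::topological_space \<Rightarrow> real"
  assumes "connected S" "continuous_on S f" "\<And>x. x \<in> S \<Longrightarrow> f x \<noteq> 0" "x \<in> S" "y \<in> S"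
  shows "sgn (f x) = sgn (f y)"
proof (rule ccontr)
  assume "sgn (f x) \<noteq> sgn (f y)"
  moreover have "f x \<noteq> 0" "f y \<noteq> 0" using assms by auto
  ultimately have "0 \<in> {f x..f y} \<union> {f y..f x}" by (auto simp: sgn_if split: if_splits)
  moreover have "connected (f ` S)" using assms by (intro connected_continuous_image)
  then have "{f x..f y} \<subseteq> f ` S" "{f y..f x} \<subseteq> f ` S"
    using assms connected_contains_Icc by blast+
  ultimately have "0 \<in> f ` S" by blast
  then show False using assms(3) by force
qed

text \<open>The two functions have the same zeros, so \<open>Phi q \<phi>\<close> does not vanish on
  either connected side of the graph of \<open>p\<close> and keeps its sign there. The two signs may
  be opposite; only constancy is claimed.\<close>

lemma Phi_coincide_sgn:
  assumes sub: "\<And>x. Phi q \<phi> (rotated_point \<theta> p x) = 0"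
    and eq: "sgn (Phi p \<theta> z) = sgn (Phi p \<theta> w)"
  shows "sgn (Phi q \<phi> z) = sgn (Phi q \<phi> w)"
proof -
  consider "Phi p \<theta> z = 0" | "0 < Phi p \<theta> z" | "Phi p \<theta> z < 0" by linarith
  then show ?thesis
  proof cases
    case 1
    then have "Phi p \<theta> w = 0" using eq by (simp add: sgn_0_0)
    then show ?thesis using 1 Phi_coincide[OF sub, of z] Phi_coincide[OF sub, of w] by simp
  next
    case 2
    then have "0 < Phi p \<theta> w" using eq by (metis sgn_1_pos)
    then show ?thesis
      using sgn_constant_on_connected[OF connected_Phi_side(2) continuous_on_Phi, of p \<theta> q \<phi> z w]
        2 Phi_coincide[OF sub] by auto
  next
    case 3
    then have "Phi p \<theta> w < 0" using eq by (metis sgn_1_neg)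
    then show ?thesis
      using sgn_constant_on_connected[OF connected_Phi_side(1) continuous_on_Phi, of p \<theta> q \<phi> z w]
        3 Phi_coincide[OF sub] by auto
  qed
qed

lemma open_same_sgn:
  fixes f :: "'a::topological_space \<Rightarrow> real"
  assumes "continuous_on UNIV f" "f x \<noteq> 0"
  shows "open {y. sgn (f y) = sgn (f x)}"
proof (cases "0 < f x")
  case True
  then have "{y. sgn (f y) = sgn (f x)} = {y. 0 < f y}" by (auto simp: sgn_if split: if_splits)
  then show ?thesis using assms(1) by (simp add: open_Collect_less)
next
  case False
  then have "{y. sgn (f y) = sgn (f x)} = {y. f y < 0}" using assms(2) by (auto simp: sgn_if split: if_splits)
  then show ?thesis using assms(1) by (simp add: open_Collect_less)
qed

section \<open>Sign conditions and exceptional points\<close>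

text \<open>Stands in for the description of \<open>X\<close> as a union of basic sets: the local
  structure of \<open>X\<close> is read off from sign vectors alone.\<close>

definition sgn_determined :: "(real poly \<times> real) set \<Rightarrow> (real \<times> real) set \<Rightarrow> bool" where
  "sgn_determined Q X \<longleftrightarrow>
     (\<forall>z w. (\<forall>(q, \<phi>)\<in>Q. sgn (Phi q \<phi> z) = sgn (Phi q \<phi> w)) \<longrightarrow> (z \<in> X \<longleftrightarrow> w \<in> X))"

definition zero_curves :: "(real poly \<times> real) set \<Rightarrow> (real \<times> real) set" where
  "zero_curves Q = (\<Union>(q, \<phi>)\<in>Q. {z. Phi q \<phi> z = 0})"

lemma closed_zero_curves: "finite Q \<Longrightarrow> closed (zero_curves Q)"
  unfolding zero_curves_def
  by (intro closed_UN) (auto intro!: closed_Collect_eq continuous_on_Phi)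

lemma open_same_sgns:
  assumes "finite Q" "\<And>q \<phi>. (q, \<phi>) \<in> Q \<Longrightarrow> Phi q \<phi> z \<noteq> 0"
  shows "open {w. \<forall>(q, \<phi>)\<in>Q. sgn (Phi q \<phi> w) = sgn (Phi q \<phi> z)}"
proof -
  have "open (\<Inter>r\<in>Q. {w. sgn (Phi (fst r) (snd r) w) = sgn (Phi (fst r) (snd r) z)})"
    using assms by (intro open_INT ballI open_same_sgn continuous_on_Phi) auto
  moreover have "(\<Inter>r\<in>Q. {w. sgn (Phi (fst r) (snd r) w) = sgn (Phi (fst r) (snd r) z)})
      = {w. \<forall>(q, \<phi>)\<in>Q. sgn (Phi q \<phi> w) = sgn (Phi q \<phi> z)}"
    by (auto simp: case_prod_unfold)
  ultimately show ?thesis by simp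
qed

text \<open>Off the zero curves no sign is zero, so all signs persist in a neighbourhood, and with
  them membership in \<open>X\<close>.\<close>

lemma open_off_zero_curves:
  assumes "finite Q" "sgn_determined Q X"
  shows "open (X - zero_curves Q)"
proof (subst open_subopen, intro ballI)
  fix z assume z: "z \<in> X - zero_curves Q"
  let ?N = "{w. \<forall>(q, \<phi>)\<in>Q. sgn (Phi q \<phi> w) = sgn (Phi q \<phi> z)}"
  have nz: "Phi q \<phi> z \<noteq> 0" if "(q, \<phi>) \<in> Q" for q \<phi>
    using z that unfolding zero_curves_def by auto
  have "?N \<subseteq> X - zero_curves Q"
  proof
    fix w assume w: "w \<in> ?N"
    then have "w \<in> X" using assms(2) z unfolding sgn_determined_def by blast
    moreover have "Phi q \<phi> w \<noteq> 0" if "(q, \<phi>) \<in> Q" for q \<phi>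
      using w nz[OF that] that by (auto simp: sgn_0_0 dest!: bspec)
    ultimately show "w \<in> X - zero_curves Q" unfolding zero_curves_def by auto
  qed
  then show "\<exists>T. open T \<and> z \<in> T \<and> T \<subseteq> X - zero_curves Q"
    using open_same_sgns[OF assms(1) nz] by (intro exI[of _ ?N]) auto
qed

text \<open>The existential quantifier restricts the first part to zero curves that do not contain
  the whole graph. The second part collects the zeros of the second derivative, with none for a
  straight line.\<close>

definition exceptional :: "(real poly \<times> real) set \<Rightarrow> real poly \<Rightarrow> real \<Rightarrow> real set" where
  "exceptional Q p \<theta> =
     (\<Union>(q, \<phi>)\<in>Q. {x. Phi q \<phi> (rotated_point \<theta> p x) = 0 \<and> (\<exists>y. Phi q \<phi> (rotated_point \<theta> p y) \<noteq> 0)})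
     \<union> {x. poly (pderiv (pderiv p)) x = 0 \<and> pderiv (pderiv p) \<noteq> 0}"

lemma finite_exceptional:
  assumes "finite Q"
  shows "finite (exceptional Q p \<theta>)"
proof -
  have "finite {x. Phi q \<phi> (rotated_point \<theta> p x) = 0 \<and> (\<exists>y. Phi q \<phi> (rotated_point \<theta> p y) \<noteq> 0)}" for q \<phi>
  proof -
    obtain f where f: "\<And>x. Phi q \<phi> (rotated_point \<theta> p x) = poly f x" using Phi_along_graph by blast
    show ?thesis using poly_roots_finite[of f] by (cases "f = 0") (simp_all add: f)
  qed
  moreover have "finite {x. poly (pderiv (pderiv p)) x = 0 \<and> pderiv (pderiv p) \<noteq> 0}"
    using poly_roots_finite[of "pderiv (pderiv p)"] by (cases "pderiv (pderiv p) = 0") simp_all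
  ultimately show ?thesis unfolding exceptional_def using assms by auto
qed

lemma fine_arcs_off_exceptional:
  assumes "finite Q" "sgn_determined Q X"
    and x0: "x0 \<notin> exceptional Q p \<theta>" "rotated_point \<theta> p x0 \<in> X"
  shows "\<exists>\<delta>>0. \<forall>a b. x0 - \<delta> < a \<longrightarrow> a < b \<longrightarrow> b < x0 + \<delta> \<longrightarrow> fine_cell X (rotated_point \<theta> p ` {a<..<b})"
proof -
  let ?z = "rotated_point \<theta> p x0"
  define T where "T = {(q, \<phi>) \<in> Q. Phi q \<phi> ?z \<noteq> 0}"
  have "finite T" unfolding T_def by (rule finite_subset[OF _ assms(1)]) auto
  then have "open {w. \<forall>(q, \<phi>)\<in>T. sgn (Phi q \<phi> w) = sgn (Phi q \<phi> ?z)}"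
    by (rule open_same_sgns) (auto simp: T_def)
  moreover have "?z \<in> {w. \<forall>(q, \<phi>)\<in>T. sgn (Phi q \<phi> w) = sgn (Phi q \<phi> ?z)}" by auto
  ultimately obtain R where R: "0 < R"
      "ball ?z R \<subseteq> {w. \<forall>(q, \<phi>)\<in>T. sgn (Phi q \<phi> w) = sgn (Phi q \<phi> ?z)}"
    using open_contains_ball by blast
  \<comment> \<open>Curves of \<open>Q\<close> that miss \<open>?z\<close> have constant sign on the
    ball. The others contain the whole graph, as \<open>x0\<close> is not exceptional, so their
    signs depend only on that of \<open>Phi p \<theta>\<close>. Membership in \<open>X\<close> on
    the ball is thus a function of the latter sign.\<close>
  have same: "w \<in> X \<longleftrightarrow> w' \<in> X"
    if w: "w \<in> ball ?z R" "w' \<in> ball ?z R" and eq: "sgn (Phi p \<theta> w) = sgn (Phi p \<theta> w')" for w w'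
  proof -
    have "sgn (Phi q \<phi> w) = sgn (Phi q \<phi> w')" if q: "(q, \<phi>) \<in> Q" for q \<phi>
    proof (cases "Phi q \<phi> ?z = 0")
      case True
      then have "Phi q \<phi> (rotated_point \<theta> p x) = 0" for x
        using x0(1) q unfolding exceptional_def by auto
      then show ?thesis using Phi_coincide_sgn eq by blast
    next
      case False
      then have "(q, \<phi>) \<in> T" using q unfolding T_def by simp
      then have "sgn (Phi q \<phi> v) = sgn (Phi q \<phi> ?z)" if "v \<in> ball ?z R" for v
        using R(2) that by blast
      then show ?thesis using w by metis
    qed
    then show ?thesis using assms(2) unfolding sgn_determined_def by blast
  qed
  have z_ball: "?z \<in> ball ?z R" using R by simp
  show ?thesis
  proof (rule rotated.fine_arcs[OF R(1)])
    show "poly (pderiv (pderiv p)) x0 \<noteq> 0 \<or> pderiv (pderiv p) = 0"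
      using x0(1) unfolding exceptional_def by auto
    show "\<forall>w\<in>ball ?z R. rotated.height \<theta> p w = 0 \<longrightarrow> w \<in> X"
      using same[OF _ z_ball] x0(2) by (auto simp: rotated_height)
    show "(\<forall>w\<in>ball ?z R. 0 < rotated.height \<theta> p w \<longrightarrow> w \<in> X)
        \<or> (\<forall>w\<in>ball ?z R. 0 < rotated.height \<theta> p w \<longrightarrow> w \<notin> X)"
      using same unfolding rotated_height neg_0_less_iff_less by (metis sgn_neg)
    show "(\<forall>w\<in>ball ?z R. rotated.height \<theta> p w < 0 \<longrightarrow> w \<in> X)
        \<or> (\<forall>w\<in>ball ?z R. rotated.height \<theta> p w < 0 \<longrightarrow> w \<notin> X)"
      using same unfolding rotated_height neg_less_0_iff_less by (metis sgn_pos)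
  qed
qed

section \<open>Assembling the decomposition\<close>

text \<open>The decomposition is made on the parameter line and carried over by the injective
  parametrization. The open set \<open>U\<close> is there to remove the curves treated
  earlier.\<close>

lemma decomposable_graph:
  assumes "finite Q" "sgn_determined Q X" "open U"
  shows "decomposable (fine_cell X) (X \<inter> {z. Phi p \<theta> z = 0} \<inter> U)"
proof -
  let ?c = "rotated_point \<theta> p"
  \<comment> \<open>The parameters around which all small arcs are fine. They form an open set, and
    the parameters of \<open>S\<close> left out are exceptional, hence finite in number and taken as
    single points.\<close>
  define G where "G = {x. ?c x \<in> X \<and>
    (\<exists>\<delta>>0. \<forall>a b. x - \<delta> < a \<longrightarrow> a < b \<longrightarrow> b < x + \<delta> \<longrightarrow> fine_cell X (?c ` {a<..<b}))}"
  define S where "S = {x. ?c x \<in> X \<inter> U}"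
  have "open G"
  proof (subst open_subopen, intro ballI)
    fix x assume "x \<in> G"
    then obtain \<delta> where d: "\<delta> > 0"
        "\<And>a b. x - \<delta> < a \<Longrightarrow> a < b \<Longrightarrow> b < x + \<delta> \<Longrightarrow> fine_cell X (?c ` {a<..<b})"
      unfolding G_def by blast
    have "y \<in> G" if y: "y \<in> ball x (\<delta> / 2)" for y
    proof -
      have fine: "fine_cell X (?c ` {a<..<b})" if "y - \<delta> / 2 < a" "a < b" "b < y + \<delta> / 2" for a b
      proof (rule d(2))
        have "\<bar>x - y\<bar> < \<delta> / 2" using y by (simp add: dist_real_def)
        then show "x - \<delta> < a" "b < x + \<delta>" using that by linarith+
      qed (rule that)
      have "?c y \<in> ?c ` {y - \<delta> / 4<..<y + \<delta> / 4}" using d(1) by auto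
      moreover have "fine_cell X (?c ` {y - \<delta> / 4<..<y + \<delta> / 4})" using fine d(1) by auto
      ultimately have "?c y \<in> X" unfolding fine_cell_def by blast
      then show ?thesis unfolding G_def using fine d(1) by (auto intro!: exI[of _ "\<delta> / 2"])
    qed
    then show "\<exists>T. open T \<and> x \<in> T \<and> T \<subseteq> G"
      using d(1) by (intro exI[of _ "ball x (\<delta> / 2)"]) auto
  qed
  moreover have "open (?c -` U)"
    by (rule open_vimage[OF assms(3) rotated.continuous_on_graph_point])
  ultimately have "open (G \<inter> ?c -` U)" by blast
  then have "decomposable (\<lambda>e. fine_cell X (?c ` e)) (G \<inter> ?c -` U)"
    by (rule decomposable_open_real) (auto simp: G_def intro: fine_cell_point)
  then have "decomposable (fine_cell X) (?c ` (G \<inter> ?c -` U))"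
    by (rule decomposable_image[OF _ rotated.inj_graph_point])
  moreover have "S - G \<subseteq> exceptional Q p \<theta>"
    using fine_arcs_off_exceptional[OF assms(1,2)] unfolding S_def G_def by blast
  then have "finite (S - G)" using finite_exceptional[OF assms(1)] finite_subset by blast
  then have "decomposable (fine_cell X) (?c ` (S - G))"
    by (intro decomposable_countable fine_cell_point) (auto simp: S_def intro: countable_finite)
  moreover have "?c ` (G \<inter> ?c -` U) \<inter> ?c ` (S - G) = {}"
    by (subst image_Int[OF rotated.inj_graph_point, symmetric]) auto
  ultimately have "decomposable (fine_cell X) (?c ` (G \<inter> ?c -` U) \<union> ?c ` (S - G))"
    by (rule decomposable_Un)
  moreover have "?c ` (G \<inter> ?c -` U) \<union> ?c ` (S - G) = ?c ` S"
    unfolding S_def G_def by blast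
  moreover have "?c ` S = X \<inter> {z. Phi p \<theta> z = 0} \<inter> U"
  proof (intro equalityI subsetI)
    fix z assume z: "z \<in> X \<inter> {z. Phi p \<theta> z = 0} \<inter> U"
    then have "z = ?c (z \<bullet> (cos \<theta>, sin \<theta>))" using rotated_point_eq by simp
    then show "z \<in> ?c ` S" unfolding S_def using z by (metis (mono_tags) Int_iff imageI mem_Collect_eq)
  qed (auto simp: S_def)
  ultimately show ?thesis by simp
qed

text \<open>Each new graph contributes only its part off the earlier curves. Their union is closed,
  so this part is cut out by an open set, and no point is covered twice.\<close>

lemma decomposable_zero_curves:
  assumes "finite Q" "sgn_determined Q X" "finite T"
  shows "decomposable (fine_cell X) (X \<inter> zero_curves T)"
  using assms(3)
proof (induction T rule: finite_induct)
  case empty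
  have "decomposable (fine_cell X) {}" by (rule decomposable_countable) simp_all
  then show ?case unfolding zero_curves_def by simp
next
  case (insert r T)
  obtain p \<theta> where r: "r = (p, \<theta>)" by fastforce
  have "X \<inter> zero_curves (insert r T)
      = (X \<inter> zero_curves T) \<union> (X \<inter> {z. Phi p \<theta> z = 0} \<inter> - zero_curves T)"
    unfolding r zero_curves_def by auto
  moreover have "decomposable (fine_cell X) (X \<inter> {z. Phi p \<theta> z = 0} \<inter> - zero_curves T)"
    by (rule decomposable_graph[OF assms(1,2)])
       (simp add: open_Compl closed_zero_curves insert.hyps(1))
  ultimately show ?case using decomposable_Un[OF insert.IH] by auto
qed

theorem theorem4p10:
  fixes F :: "((real poly \<times> real) list \<times> (real poly \<times> real) list) set"
    and X :: "(real \<times> real) set"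
  assumes "finite F"
    and "X = (\<Union>(eqs, ineqs)\<in>F. basic_set eqs ineqs)"
  shows "\<exists>C. cell_decomposition C X \<and>
           (\<forall>A\<in>X. \<forall>B\<in>X. \<forall>\<gamma>. shortest_curve X A B \<gamma> \<longrightarrow> (\<forall>e\<in>C. interacts_finitely \<gamma> e))"
proof -
  define Q where "Q = (\<Union>(eqs, ineqs)\<in>F. set eqs \<union> set ineqs)"
  have Q: "finite Q" unfolding Q_def using assms(1) by auto
  have det: "sgn_determined Q X"
    unfolding sgn_determined_def
  proof (intro allI impI)
    fix z w assume eq: "\<forall>(q, \<phi>)\<in>Q. sgn (Phi q \<phi> z) = sgn (Phi q \<phi> w)"
    have "z \<in> basic_set eqs ineqs \<longleftrightarrow> w \<in> basic_set eqs ineqs" if "(eqs, ineqs) \<in> F" for eqs ineqs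
    proof -
      have s: "sgn (Phi q \<phi> z) = sgn (Phi q \<phi> w)" if "(q, \<phi>) \<in> set eqs \<union> set ineqs" for q \<phi>
        using eq that \<open>(eqs, ineqs) \<in> F\<close> unfolding Q_def by blast
      have "Phi q \<phi> z = 0 \<longleftrightarrow> Phi q \<phi> w = 0" "0 < Phi q \<phi> z \<longleftrightarrow> 0 < Phi q \<phi> w"
        if "(q, \<phi>) \<in> set eqs \<union> set ineqs" for q \<phi>
        using s[OF that] by (metis sgn_0_0, metis sgn_1_pos)
      then show ?thesis unfolding basic_set_def by fastforce
    qed
    then show "z \<in> X \<longleftrightarrow> w \<in> X" unfolding assms(2) by blast
  qed
  have "decomposable (fine_cell X) ((X - zero_curves Q) \<union> (X \<inter> zero_curves Q))"
    by (rule decomposable_Un[OF decomposable_open_subset[OF open_off_zero_curves[OF Q det]]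
          decomposable_zero_curves[OF Q det Q]]) auto
  moreover have "(X - zero_curves Q) \<union> (X \<inter> zero_curves Q) = X" by blast
  ultimately obtain C where "countable C" "disjoint C" "\<Union>C = X" "\<forall>e\<in>C. fine_cell X e"
    unfolding decomposable_def by auto
  then show ?thesis
    unfolding cell_decomposition_def fine_cell_def by (intro exI[of _ C]) auto
qed

end
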